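(* Consider an instance of the deadline scheduling problem described in the context, for which there exists an assignment $\mathcal{S}'$ as described there. Then there is a polynomial-time algorithm that computes a set $A_{\mathrm{discarded}}$ of tasks and a schedule $\mathcal{S}$ of the remaining tasks $A(J)\setminus A_{\mathrm{discarded}}$ such that: (1) every task is assigned to a (machine, slot) pair $(i,t)$ with $\mathsf{cap}_i(t)=1$, and no two tasks are assigned to the same pair; (2) for every job $j$, all its non-discarded tasks are assigned to one and the same machine (no migration); (3) the precedence constraints are satisfied: for any two non-discarded tasks $a \prec a'$, the slot of $a$ is strictly smaller than the slot of $a'$; (4) $|A_{\mathrm{discarded}}| \le 2p^2 m\,\Delta(J)$.
   Context: Deadline scheduling problem with precedence constraints: there are $m$ machines and time slots $[T]=\{1,\dots,T\}$, partitioned into $p$ consecutive intervals $I_1,\dots,I_p$ of equal length. There is a set $J$ of jobs; job $j$ has a positive integer length $p_j$ and consists of $p_j$ unit tasks $a_{1,j} \prec a_{2,j}\prec\dots\prec a_{p_j,j}$; $A(j)$ denotes its set of tasks and $A(J)=\bigcup_j A(j)$. Each job has a release time $r_j$ and deadline $d_j$ (a window $[r_j,d_j]$ of slots), where each $r_j$ is the first slot of some interval $I_q$ and each $d_j$ is the last slot of some interval $I_{q'}$. The jobs carry a partial order $\prec$ with the property that $j\prec j'$ implies $r_j\le r_{j'}$ and $d_j\le d_{j'}$; for $j\prec j'$ every task of $j$ precedes every task of $j'$. $\Delta(J)$ denotes the maximum, over all chains (totally ordered subsets) $C\subseteq J$, of $\sum_{j\in C}p_j$. For each machine $i$ a capacity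 function $\mathsf{cap}_i:[T]\to\{0,1\}$ is given; slot $t$ on machine $i$ is available iff $\mathsf{cap}_i(t)=1$. It is assumed that there exists an assignment $\mathcal{S}':A(J)\to[m]\times[T]$ mapping tasks injectively to available (machine, slot) pairs such that every task of each job $j$ is placed in a slot in $[r_j,d_j]$ ($\mathcal{S}'$ need not respect precedence or no-migration). *)

theory Defs
  imports
    Complex_Main
    "HOL-Library.Log_Nat"
    "HOL-Computational_Algebra.Polynomial"
begin

section \<open>Instances\<close>

text \<open>Jobs, machines and slots are numbered from 1. The values of the function fields matter
  only on the ranges \<open>jobs\<close>, \<open>machines\<close> and \<open>slots\<close> below.\<close>

record inst =
  num_machines :: nat
  horizon :: nat
  num_intervals :: nat
  num_jobs :: nat
  len :: "nat \<Rightarrow> nat"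
  release :: "nat \<Rightarrow> nat"
  deadline :: "nat \<Rightarrow> nat"
  prec :: "nat \<Rightarrow> nat \<Rightarrow> bool"
  cap :: "nat \<Rightarrow> nat \<Rightarrow> nat"

definition jobs :: "inst \<Rightarrow> nat set" where
  "jobs I = {1..num_jobs I}"

definition machines :: "inst \<Rightarrow> nat set" where
  "machines I = {1..num_machines I}"

definition slots :: "inst \<Rightarrow> nat set" where
  "slots I = {1..horizon I}"

definition interval :: "inst \<Rightarrow> nat \<Rightarrow> nat set" where
  "interval I q =
     (let l = horizon I div num_intervals I in {(q - 1) * l + 1..q * l})"

definition valid_inst :: "inst \<Rightarrow> bool" where
  "valid_inst I \<longleftrightarrow>
     num_intervals I dvd horizon I \<and>
     (\<forall>j\<in>jobs I. len I j > 0) \<and>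
     (\<forall>j\<in>jobs I. \<exists>q\<in>{1..num_intervals I}. release I j = Min (interval I q)) \<and>
     (\<forall>j\<in>jobs I. \<exists>q\<in>{1..num_intervals I}. deadline I j = Max (interval I q)) \<and>
     irreflp_on (jobs I) (prec I) \<and>
     transp_on (jobs I) (prec I) \<and>
     (\<forall>j\<in>jobs I. \<forall>j'\<in>jobs I. prec I j j' \<longrightarrow>
        release I j \<le> release I j' \<and> deadline I j \<le> deadline I j') \<and>
     (\<forall>i\<in>machines I. \<forall>t\<in>slots I. cap I i t \<in> {0, 1})"

text \<open>The pair \<open>(k, j)\<close> stands for the task $a_{k,j}$.\<close>

type_synonym task = "nat \<times> nat"

definition job_tasks :: "inst \<Rightarrow> nat \<Rightarrow> task set" where
  "job_tasks I j = {1..len I j} \<times> {j}"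

definition tasks :: "inst \<Rightarrow> task set" where
  "tasks I = (\<Union>j\<in>jobs I. job_tasks I j)"

definition task_prec :: "inst \<Rightarrow> task \<Rightarrow> task \<Rightarrow> bool" where
  "task_prec I a a' \<longleftrightarrow>
     (snd a = snd a' \<and> fst a < fst a') \<or> prec I (snd a) (snd a')"

definition max_chain :: "inst \<Rightarrow> nat" where
  "max_chain I = Max {\<Sum>j\<in>C. len I j | C. C \<subseteq> jobs I \<and> totalp_on C (prec I)}"

definition available :: "inst \<Rightarrow> (nat \<times> nat) set" where
  "available I = {(i, t). i \<in> machines I \<and> t \<in> slots I \<and> cap I i t = 1}"

definition window_assignment :: "inst \<Rightarrow> (task \<Rightarrow> nat \<times> nat) \<Rightarrow> bool" where
  "window_assignment I S \<longleftrightarrow>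
     S ` tasks I \<subseteq> available I \<and> inj_on S (tasks I) \<and>
     (\<forall>j\<in>jobs I. \<forall>a\<in>job_tasks I j. snd (S a) \<in> {release I j..deadline I j})"


section \<open>Model of computation\<close>

text \<open>Programs are while programs over zero-initialised, unbounded two-dimensional arrays of
  natural numbers (a scalar is the cell with indices 0, 0). Every assignment and every test costs
  one unit of time. As a program is a fixed finite object and the only arithmetic operations are
  addition and truncated subtraction, the bit length of the stored numbers grows by at most a
  constant per unit of time; hence polynomial time in this model is the usual polynomial time.
  Multiplication is left out because at unit cost it would break this.\<close>

type_synonym memory = "string \<Rightarrow> nat \<Rightarrow> nat \<Rightarrow> nat"

datatype aexp =
    Num nat
  | Cell string aexp aexp
  | Plus aexp aexp
  | Minus aexp aexp

fun aval :: "aexp \<Rightarrow> memory \<Rightarrow> nat" where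
  "aval (Num n) s = n"
| "aval (Cell x a b) s = s x (aval a s) (aval b s)"
| "aval (Plus a b) s = aval a s + aval b s"
| "aval (Minus a b) s = aval a s - aval b s"

datatype bexp =
    Less aexp aexp
  | Equal aexp aexp
  | Neg bexp
  | And bexp bexp

fun bval :: "bexp \<Rightarrow> memory \<Rightarrow> bool" where
  "bval (Less a b) s \<longleftrightarrow> aval a s < aval b s"
| "bval (Equal a b) s \<longleftrightarrow> aval a s = aval b s"
| "bval (Neg b) s \<longleftrightarrow> \<not> bval b s"
| "bval (And b c) s \<longleftrightarrow> bval b s \<and> bval c s"

datatype com =
    Skip
  | Assign string aexp aexp aexp
  | Seq com com
  | Cond bexp com com
  | While bexp com

definition update :: "memory \<Rightarrow> string \<Rightarrow> nat \<Rightarrow> nat \<Rightarrow> nat \<Rightarrow> memory" where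
  "update s x a b v = s(x := (s x)(a := (s x a)(b := v)))"

text \<open>\<open>exec c s n s'\<close>: started in memory \<open>s\<close>, program \<open>c\<close> halts in memory \<open>s'\<close> after time \<open>n\<close>.\<close>

inductive exec :: "com \<Rightarrow> memory \<Rightarrow> nat \<Rightarrow> memory \<Rightarrow> bool" where
  Skip: "exec Skip s 1 s"
| Assign: "exec (Assign x a b e) s 1 (update s x (aval a s) (aval b s) (aval e s))"
| Seq: "exec c s n s' \<Longrightarrow> exec d s' n' s'' \<Longrightarrow> exec (Seq c d) s (n + n') s''"
| CondTrue: "bval b s \<Longrightarrow> exec c s n s' \<Longrightarrow> exec (Cond b c d) s (n + 1) s'"
| CondFalse: "\<not> bval b s \<Longrightarrow> exec d s n s' \<Longrightarrow> exec (Cond b c d) s (n + 1) s'"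
| WhileFalse: "\<not> bval b s \<Longrightarrow> exec (While b c) s 1 s"
| WhileTrue: "bval b s \<Longrightarrow> exec c s n s' \<Longrightarrow> exec (While b c) s' n' s'' \<Longrightarrow>
    exec (While b c) s (n + n' + 1) s''"


section \<open>Input and output of a scheduling algorithm\<close>

definition input :: "inst \<Rightarrow> memory" where
  "input I x a b =
     (if x = ''machines'' \<and> a = 0 \<and> b = 0 then num_machines I
      else if x = ''horizon'' \<and> a = 0 \<and> b = 0 then horizon I
      else if x = ''intervals'' \<and> a = 0 \<and> b = 0 then num_intervals I
      else if x = ''jobs'' \<and> a = 0 \<and> b = 0 then num_jobs I
      else if x = ''len'' \<and> a \<in> jobs I \<and> b = 0 then len I a
      else if x = ''release'' \<and> a \<in> jobs I \<and> b = 0 then release I a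
      else if x = ''deadline'' \<and> a \<in> jobs I \<and> b = 0 then deadline I a
      else if x = ''prec'' \<and> a \<in> jobs I \<and> b \<in> jobs I then of_bool (prec I a b)
      else if x = ''cap'' \<and> a \<in> machines I \<and> b \<in> slots I then cap I a b
      else 0)"

text \<open>Length of the input with numbers written in binary (\<open>floorlog 2 x\<close> is the number of
  binary digits of \<open>x\<close>) and one bit for each entry of the tables \<open>prec\<close> and \<open>cap\<close>.\<close>

definition input_size :: "inst \<Rightarrow> nat" where
  "input_size I =
     floorlog 2 (num_machines I) + floorlog 2 (horizon I) +
     floorlog 2 (num_intervals I) + floorlog 2 (num_jobs I) +
     (\<Sum>j\<in>jobs I. floorlog 2 (len I j) + floorlog 2 (release I j) + floorlog 2 (deadline I j)) +
     num_jobs I * num_jobs I + num_machines I * horizon I"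

definition discarded :: "inst \<Rightarrow> memory \<Rightarrow> task set" where
  "discarded I s = {(k, j) \<in> tasks I. s ''discarded'' k j \<noteq> 0}"

definition schedule :: "memory \<Rightarrow> task \<Rightarrow> nat \<times> nat" where
  "schedule s = (\<lambda>(k, j). (s ''machine'' k j, s ''slot'' k j))"

definition good_schedule :: "inst \<Rightarrow> task set \<Rightarrow> (task \<Rightarrow> nat \<times> nat) \<Rightarrow> bool" where
  "good_schedule I D S \<longleftrightarrow>
     S ` (tasks I - D) \<subseteq> available I \<and> inj_on S (tasks I - D) \<and>
     (\<forall>j\<in>jobs I. \<exists>i. \<forall>a\<in>job_tasks I j - D. fst (S a) = i) \<and>
     (\<forall>a\<in>tasks I - D. \<forall>a'\<in>tasks I - D. task_prec I a a' \<longrightarrow> snd (S a) < snd (S a'))"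

end

theory Submission
  imports Defs
begin

text \<open>List scheduling with reserved machines. In each step, every available machine continues its
  unfinished job, or else starts a job all of whose predecessors were finished before the step. If some
  available machine finds nothing to do, then in addition every started job whose machine is unavailable
  loses its next task, which is discarded. At such an idle step every minimal unfinished job makes
  progress, so the longest chain of remaining tasks gets shorter; hence there are at most
  $\Delta(J)$ idle steps \<open>K\<close> with unfinished jobs. A reserved machine serves one job at a time, so tasks
  lost at idle steps inject into $[m] \times K$. If tasks remain at the end, then all
  available slots outside $[m] \times K$ are used, and as the assignment $\mathcal{S}'$ shows that there
  are at least as many available slots as tasks, the total number of discarded tasks is at most $m |K|$.\<close>

section \<open>Invariants of the schedule\<close>

text \<open>Readiness is judged by \<open>D0\<close>, the state before the step, because slots must
  increase strictly along a precedence. The set \<open>K\<close> exists only in the proof; the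
  program keeps just a flag \<open>idle\<close> for the current step. The assignment S' enters
  through two counts. The number of tasks is at most the number of available pairs, which bounds the
  loss; and a single job has at most m T tasks, so loops over its tasks are affordable although
  lengths are coded in binary. The loss is at most m \<Delta>; the factor 2 p^2 only enlarges this
  bound, as p > 0 once there is a job.\<close>

definition advanced :: "inst \<Rightarrow> (nat \<Rightarrow> nat) \<Rightarrow> task set" where
  "advanced I D = {(k, j). j \<in> jobs I \<and> 1 \<le> k \<and> k \<le> D j}"

definition place :: "(nat \<Rightarrow> nat) \<Rightarrow> (nat \<Rightarrow> nat \<Rightarrow> nat) \<Rightarrow> task \<Rightarrow> nat \<times> nat" where
  "place M SL = (\<lambda>(k, j). (M j, SL k j))"

text \<open>The state after part of step \<open>t\<close>: \<open>D j\<close> tasks of job \<open>j\<close> have been consumed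
  (\<open>D0 j\<close> of them before step \<open>t\<close>), \<open>M j\<close> is the machine of \<open>j\<close> (0 before \<open>j\<close> starts) and \<open>SL k j\<close> is
  the step that consumed task \<open>(k, j)\<close>. Consumed tasks are placed injectively and in order, but possibly on
  unavailable slots; these tasks are the ones to be discarded, and they occur only at steps in \<open>K\<close>,
  the steps that leave an available machine idle although some job is unfinished.\<close>

definition core :: "inst \<Rightarrow> nat set \<Rightarrow> nat \<Rightarrow> (nat \<Rightarrow> nat) \<Rightarrow> (nat \<Rightarrow> nat) \<Rightarrow> (nat \<Rightarrow> nat) \<Rightarrow>
    (nat \<Rightarrow> nat \<Rightarrow> nat) \<Rightarrow> bool" where
  "core I K t D0 D M SL \<longleftrightarrow>
     (\<forall>j\<in>jobs I. D0 j \<le> D j \<and> D j \<le> len I j \<and> M j \<le> num_machines I \<and> (M j = 0 \<longleftrightarrow> D j = 0)) \<and>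
     (\<forall>j\<in>jobs I. \<forall>j'\<in>jobs I. D0 j < len I j \<longrightarrow> D0 j' < len I j' \<longrightarrow> M j = M j' \<longrightarrow> M j \<noteq> 0 \<longrightarrow>
        j = j') \<and>
     (\<forall>(k, j)\<in>advanced I D. 0 < SL k j \<and> SL k j \<le> t \<and> (k \<le> D0 j \<longrightarrow> SL k j < t)) \<and>
     (\<forall>j\<in>jobs I. \<forall>k>D j. SL k j = 0) \<and>
     inj_on (place M SL) (advanced I D) \<and>
     (\<forall>a\<in>advanced I D. \<forall>a'\<in>advanced I D. task_prec I a a' \<longrightarrow>
        snd (place M SL a) < snd (place M SL a')) \<and>
     (\<forall>h\<in>jobs I. \<forall>j\<in>jobs I. prec I h j \<longrightarrow> 0 < D j \<longrightarrow> D0 h = len I h) \<and>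
     (\<forall>a\<in>advanced I D. place M SL a \<notin> available I \<longrightarrow> snd (place M SL a) \<in> K)"

section \<open>Consuming one task and passing to the next step\<close>

text \<open>A task already at \<open>(i, t)\<close> would belong to a job on machine
  \<open>i\<close> that was unfinished before the step. If \<open>c\<close> is being continued,
  exclusivity makes that job \<open>c\<close> itself, which has not moved yet; if \<open>c\<close>
  is being started, such a job would block the start. So the pair is fresh. All predecessors of the
  new task were consumed before the step, hence at smaller slots. The disjunction \<open>K\<close>
  covers regular runs as well as tasks lost at idle steps.\<close>

lemma core_advance:
  assumes core: "core I K t D0 D M SL" and irr: "irreflp_on (jobs I) (prec I)"
    and c: "c \<in> jobs I" "D c = D0 c" "D c < len I c"
    and i: "i \<in> machines I" and t: "0 < t"
    and M: "M c = i \<or> M c = 0 \<and> (\<forall>j\<in>jobs I. D0 j < len I j \<longrightarrow> M j \<noteq> i) \<and>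
      (\<forall>h\<in>jobs I. prec I h c \<longrightarrow> D0 h = len I h)"
    and K: "(i, t) \<in> available I \<or> t \<in> K"
  shows "core I K t D0 (D(c := Suc (D c))) (M(c := i)) (SL(Suc (D c) := (SL (Suc (D c)))(c := t)))"
      (is ?core)
    and "place (M(c := i)) (SL(Suc (D c) := (SL (Suc (D c)))(c := t))) ` advanced I (D(c := Suc (D c))) =
      insert (i, t) (place M SL ` advanced I D)" (is ?image)
proof -
  let ?D = "D(c := Suc (D c))" and ?M = "M(c := i)"
    and ?SL = "SL(Suc (D c) := (SL (Suc (D c)))(c := t))"
  let ?V = "advanced I D" and ?n = "(Suc (D c), c)"
  have C1: "D0 j \<le> D j" "D j \<le> len I j" "M j \<le> num_machines I" "M j = 0 \<longleftrightarrow> D j = 0"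
    if "j \<in> jobs I" for j
    using core that unfolding core_def by blast+
  have C2: "j = j'" if "j \<in> jobs I" "j' \<in> jobs I" "D0 j < len I j" "D0 j' < len I j'" "M j = M j'"
    "M j \<noteq> 0" for j j'
    using core that unfolding core_def by blast
  have C3: "0 < SL k j" "SL k j \<le> t" "k \<le> D0 j \<Longrightarrow> SL k j < t" if "(k, j) \<in> ?V" for k j
    using core that unfolding core_def by blast+
  have C4: "SL k j = 0" if "j \<in> jobs I" "D j < k" for k j
    using core that unfolding core_def by blast
  have C5: "inj_on (place M SL) ?V"
    using core unfolding core_def by blast
  have C6: "snd (place M SL a) < snd (place M SL a')" if "a \<in> ?V" "a' \<in> ?V" "task_prec I a a'" for a a'
    using core that unfolding core_def by blast
  have C7: "D0 h = len I h" if "h \<in> jobs I" "j \<in> jobs I" "prec I h j" "0 < D j" for h j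
    using core that unfolding core_def by blast
  have C8: "snd (place M SL a) \<in> K" if "a \<in> ?V" "place M SL a \<notin> available I" for a
    using core that unfolding core_def by blast
  have i0: "i \<noteq> 0" "i \<le> num_machines I"
    using i by (auto simp: machines_def)
  have V: "advanced I ?D = insert ?n ?V"
    using c by (auto simp: advanced_def)
  have nV: "?n \<notin> ?V"
    by (auto simp: advanced_def)
  \<comment> \<open>The machine of \<open>c\<close> changes only if \<open>c\<close> is unstarted
    and so has no consumed task; the slot table changes only at the new task.\<close>
  have old: "place ?M ?SL a = place M SL a" if a: "a \<in> ?V" for a
  proof -
    obtain k j where kj: "a = (k, j)" by (cases a)
    have "j = c \<Longrightarrow> M c = i \<and> k \<noteq> Suc (D c)"
      using a kj M C1(4)[OF c(1)] by (auto simp: advanced_def)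
    then show ?thesis by (auto simp: kj place_def)
  qed
  have new: "place ?M ?SL ?n = (i, t)"
    by (simp add: place_def)
  \<comment> \<open>A job already started has this from the invariant, a job just starting from the
    start condition.\<close>
  have preds: "D0 h = len I h" if "h \<in> jobs I" "prec I h c" for h
    using M C7[OF that(1) c(1) that(2)] that i0 C1(4)[OF c(1)] by (cases "M c = 0") auto
  have before: "snd (place M SL (k, j)) < t" if "(k, j) \<in> ?V" "D j = D0 j" for k j
    using C3(3)[OF that(1)] that by (auto simp: place_def advanced_def)
  have fresh: "(i, t) \<notin> place M SL ` ?V"
  proof
    assume "(i, t) \<in> place M SL ` ?V"
    then obtain k j where kj: "(k, j) \<in> ?V" "M j = i" "SL k j = t"
      by (auto simp: place_def)
    then have j: "j \<in> jobs I" and "D0 j < k" "k \<le> D j"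
      using C3(3)[OF kj(1)] by (auto simp: advanced_def not_less[symmetric])
    then have "D0 j < len I j" "D0 j \<noteq> D j"
      using C1(2)[OF j] by auto
    then show False
    proof (cases "M c = i")
      case True
      then have "j = c" using C2[OF j c(1)] kj(2) c i0 \<open>D0 j < len I j\<close> by simp
      then show False using c(2) \<open>D0 j \<noteq> D j\<close> by simp
    qed (use M kj(2) j \<open>D0 j < len I j\<close> in blast)
  qed
  have job: "snd a \<in> jobs I" if "a \<in> ?V" for a
    using that by (auto simp: advanced_def)
  have prec_new: "snd (place M SL a) < t" if "a \<in> ?V" "task_prec I a ?n" for a
  proof -
    obtain k j where kj: "a = (k, j)" by (cases a)
    have "j = c \<or> prec I j c"
      using that(2) kj by (auto simp: task_prec_def)
    then have "D j = D0 j"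
      using c(2) preds[of j] job[OF that(1)] kj C1[of j] by auto
    then show ?thesis
      using before that(1) kj by simp
  qed
  \<comment> \<open>If \<open>c\<close> preceded a started job, \<open>c\<close> would have been
    finished before the step.\<close>
  have not_prec: "\<not> task_prec I ?n a" if "a \<in> ?V" for a
  proof
    assume *: "task_prec I ?n a"
    obtain k j where kj: "a = (k, j)" by (cases a)
    have j: "j \<in> jobs I" "0 < D j" "k \<le> D j" using that kj by (auto simp: advanced_def)
    show False
    proof (cases "prec I c j")
      case True
      then show False using C7[OF c(1) j(1) True j(2)] c by simp
    next
      case False
      then show False using * kj j by (auto simp: task_prec_def)
    qed
  qed
  have irr_n: "\<not> task_prec I ?n ?n"
    using irr c(1) by (auto simp: task_prec_def irreflp_on_def)
  have "\<forall>j\<in>jobs I. D0 j \<le> ?D j \<and> ?D j \<le> len I j \<and> ?M j \<le> num_machines I \<and> (?M j = 0 \<longleftrightarrow> ?D j = 0)"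
    using C1 c i0 by auto
  moreover have "\<forall>j\<in>jobs I. \<forall>j'\<in>jobs I. D0 j < len I j \<longrightarrow> D0 j' < len I j' \<longrightarrow> ?M j = ?M j' \<longrightarrow>
      ?M j \<noteq> 0 \<longrightarrow> j = j'"
    using C2 c M i0 by auto
  moreover have "\<forall>(k, j)\<in>insert ?n ?V. 0 < ?SL k j \<and> ?SL k j \<le> t \<and> (k \<le> D0 j \<longrightarrow> ?SL k j < t)"
    using C3 c(2) t by auto
  moreover have "\<forall>j\<in>jobs I. \<forall>k>?D j. ?SL k j = 0"
    using C4 by auto
  moreover have "inj_on (place ?M ?SL) (insert ?n ?V)"
  proof -
    have "inj_on (place ?M ?SL) ?V" "place ?M ?SL ` ?V = place M SL ` ?V"
      using C5 inj_on_cong[of ?V "place ?M ?SL" "place M SL"] old by auto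
    then show ?thesis using fresh nV unfolding inj_on_insert new by auto
  qed
  moreover have "\<forall>a\<in>insert ?n ?V. \<forall>a'\<in>insert ?n ?V. task_prec I a a' \<longrightarrow>
      snd (place ?M ?SL a) < snd (place ?M ?SL a')"
    using C6 prec_new not_prec irr_n old new by (metis insert_iff snd_conv)
  moreover have "\<forall>h\<in>jobs I. \<forall>j\<in>jobs I. prec I h j \<longrightarrow> 0 < ?D j \<longrightarrow> D0 h = len I h"
    using C7 preds by auto
  moreover have "\<forall>a\<in>insert ?n ?V. place ?M ?SL a \<notin> available I \<longrightarrow> snd (place ?M ?SL a) \<in> K"
    using C8 K old new by (metis insert_iff snd_conv)
  ultimately show ?core
    unfolding core_def V by blast
  have "place ?M ?SL ` ?V = place M SL ` ?V"
    using old by (rule image_cong[OF refl])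
  then show ?image
    unfolding V image_insert new by simp
qed

text \<open>\<open>D\<close> can serve as the new baseline because slots up to \<open>t\<close> lie
  below \<open>Suc t\<close>, and a job unfinished now was unfinished before.\<close>

lemma core_next:
  assumes "core I K t D0 D M SL"
  shows "core I K (Suc t) D D M SL"
proof -
  have "(k, j) \<in> advanced I D \<Longrightarrow> 0 < SL k j \<and> SL k j < Suc t" for k j
    using assms unfolding core_def by (auto simp: less_Suc_eq_le)
  moreover have "h \<in> jobs I \<Longrightarrow> D0 h = len I h \<Longrightarrow> D h = len I h" for h
    using assms unfolding core_def by (metis le_antisym)
  moreover have "j \<in> jobs I \<Longrightarrow> D j < len I j \<Longrightarrow> D0 j < len I j" for j
    using assms unfolding core_def by (meson le_less_trans)
  ultimately show ?thesis
    using assms unfolding core_def by (intro conjI) auto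
qed

lemma core_mono: "core I K t D0 D M SL \<Longrightarrow> K \<subseteq> K' \<Longrightarrow> core I K' t D0 D M SL"
  unfolding core_def by blast

section \<open>Occupied slots and the chain potential\<close>

definition filled :: "inst \<Rightarrow> nat set \<Rightarrow> nat \<Rightarrow> (nat \<Rightarrow> nat) \<Rightarrow> (nat \<Rightarrow> nat) \<Rightarrow>
    (nat \<Rightarrow> nat \<Rightarrow> nat) \<Rightarrow> bool" where
  "filled I K t D M SL \<longleftrightarrow>
     (\<forall>(i, u)\<in>available I. u < t \<longrightarrow> u \<notin> K \<longrightarrow> (i, u) \<in> place M SL ` advanced I D)"

text \<open>Potential argument: each step in \<open>K\<close> shortens the longest chain of remaining work.\<close>

definition short :: "inst \<Rightarrow> nat set \<Rightarrow> (nat \<Rightarrow> nat) \<Rightarrow> bool" where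
  "short I K D \<longleftrightarrow> finite K \<and> (\<forall>C\<subseteq>jobs I. totalp_on C (prec I) \<longrightarrow>
     (\<Sum>j\<in>C. len I j - D j) + card K \<le> max_chain I)"

lemma finite_jobs [simp]: "finite (jobs I)"
  by (simp add: jobs_def)

lemma short_init: "short I {} (\<lambda>j. 0)"
proof -
  have "{\<Sum>j\<in>C. len I j | C. C \<subseteq> jobs I \<and> totalp_on C (prec I)} \<subseteq> (\<lambda>C. \<Sum>j\<in>C. len I j) ` Pow (jobs I)"
    by auto
  then have fin: "finite {\<Sum>j\<in>C. len I j | C. C \<subseteq> jobs I \<and> totalp_on C (prec I)}"
    by (rule finite_subset) simp
  show ?thesis
    unfolding short_def max_chain_def by (auto intro: Max_ge[OF fin])
qed

lemma minimal_job:
  assumes irr: "irreflp_on (jobs I) (prec I)" and tr: "transp_on (jobs I) (prec I)"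
    and U: "U \<subseteq> jobs I" "U \<noteq> {}"
  obtains h where "h \<in> U" "\<forall>g\<in>U. \<not> prec I g h"
proof -
  have "\<not> prec I y x" if xy: "x \<in> U" "y \<in> U" "prec I x y" for x y
  proof
    assume "prec I y x"
    then have "prec I x x"
      using transp_onD[OF tr, of x y x] xy U(1) by blast
    then show False
      using irreflp_onD[OF irr, of x] xy(1) U(1) by blast
  qed
  then have asym: "asymp_on U (prec I)"
    by (auto intro: asymp_onI)
  have "\<exists>h\<in>U. \<forall>g\<in>U. g \<noteq> h \<longrightarrow> \<not> prec I g h"
    using Finite_Set.bex_min_element[OF finite_subset[OF U(1) finite_jobs] asym
        transp_on_subset[OF tr U(1)] U(2)] .
  then show ?thesis
    using that irreflp_onD[OF irr] U(1) by (metis subsetD)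
qed

text \<open>A minimal element among the unfinished jobs at or below \<open>j\<close> is minimal
  among all unfinished jobs: by transitivity anything below it is again below
  \<open>j\<close>.\<close>

lemma minimal_unfinished:
  assumes irr: "irreflp_on (jobs I) (prec I)" and tr: "transp_on (jobs I) (prec I)"
    and j: "j \<in> jobs I" "D j < len I j"
  obtains h where "h \<in> jobs I" "D h < len I h" "h = j \<or> prec I h j"
    "\<forall>g\<in>jobs I. prec I g h \<longrightarrow> \<not> D g < len I g"
proof -
  let ?U = "{h \<in> jobs I. D h < len I h \<and> (h = j \<or> prec I h j)}"
  have sub: "?U \<subseteq> jobs I" by auto
  have ne: "?U \<noteq> {}" using j by blast
  obtain h where h: "h \<in> ?U" "\<forall>g\<in>?U. \<not> prec I g h"
    using minimal_job[OF irr tr sub ne] by blast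
  have "\<not> D g < len I g" if g: "g \<in> jobs I" "prec I g h" for g
  proof
    assume "D g < len I g"
    moreover have "prec I g j"
      using g h(1) tr j by (auto dest: transp_onD)
    ultimately show False using h(2) g by auto
  qed
  then show ?thesis using that[of h] h(1) by blast
qed

text \<open>The jobs of a chain that are unfinished after the step can be extended downwards by a
  job \<open>h\<close> that was minimal unfinished before it. The old bound applies to the extended
  chain, and the progress of \<open>h\<close> pays for the new element of \<open>K\<close>.\<close>

lemma short_step:
  assumes irr: "irreflp_on (jobs I) (prec I)" and tr: "transp_on (jobs I) (prec I)"
    and short: "short I K D0" and le: "\<And>j. j \<in> jobs I \<Longrightarrow> D0 j \<le> D j"
    and ex: "\<exists>j\<in>jobs I. D0 j < len I j"
    and step: "\<And>j. j \<in> jobs I \<Longrightarrow> D0 j < len I j \<Longrightarrow>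
      (\<And>h. h \<in> jobs I \<Longrightarrow> prec I h j \<Longrightarrow> \<not> D0 h < len I h) \<Longrightarrow> D0 j < D j"
  shows "short I (insert t K) D"
proof -
  have "(\<Sum>j\<in>C. len I j - D j) + Suc (card K) \<le> max_chain I"
    if C: "C \<subseteq> jobs I" "totalp_on C (prec I)" for C
  proof -
    let ?C = "{j \<in> C. D j < len I j}"
    have finC: "finite C" using C(1) finite_jobs by (rule finite_subset)
    have eq: "(\<Sum>j\<in>C. len I j - D j) = (\<Sum>j\<in>?C. len I j - D j)"
      by (rule sum.mono_neutral_right) (use finC in auto)
    obtain h where h: "h \<in> jobs I" "D0 h < len I h" "\<forall>j\<in>?C. h = j \<or> prec I h j" "D0 h < D h"
    proof (cases "?C = {}")
      \<comment> \<open>An exhausted chain needs an \<open>h\<close> as well: its sum 0 must still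
        leave room for one more element of \<open>K\<close>.\<close>
      case True
      obtain j where j: "j \<in> jobs I" "D0 j < len I j" using ex by blast
      obtain h where "h \<in> jobs I" "D0 h < len I h" "\<forall>g\<in>jobs I. prec I g h \<longrightarrow> \<not> D0 g < len I g"
        using minimal_unfinished[where D = D0 and I = I, OF irr tr j] by blast
      then show ?thesis using that[of h] step[of h] True by blast
    next
      case False
      have sub: "?C \<subseteq> jobs I" using C by auto
      obtain j where j: "j \<in> ?C" "\<forall>g\<in>?C. \<not> prec I g j"
        using minimal_job[OF irr tr sub False] by blast
      then have jmin: "\<forall>g\<in>?C. j = g \<or> prec I j g"
        using C(2) by (auto simp: totalp_on_def)
      have ju: "j \<in> jobs I" "D0 j < len I j"
        using j sub le[of j] by auto
      obtain h where h: "h \<in> jobs I" "D0 h < len I h" "h = j \<or> prec I h j"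
          "\<forall>g\<in>jobs I. prec I g h \<longrightarrow> \<not> D0 g < len I g"
        using minimal_unfinished[where D = D0 and I = I, OF irr tr ju] by blast
      have "h = g \<or> prec I h g" if "g \<in> ?C" for g
      proof -
        have "g \<in> jobs I" using that sub by blast
        moreover have "j = g \<or> prec I j g" using jmin that by blast
        ultimately show ?thesis
          using h(3) transp_onD[OF tr h(1) ju(1), of g] by blast
      qed
      then show ?thesis using that[of h] step[of h] h by blast
    qed
    let ?C' = "insert h ?C"
    have C': "?C' \<subseteq> jobs I" "totalp_on ?C' (prec I)"
      using C h by (auto simp: totalp_on_def)
    \<comment> \<open>\<open>h\<close> may have finished in this step and so be absent from
      \<open>?C\<close>; splitting it off covers both cases.\<close>
    have "(\<Sum>j\<in>?C. len I j - D j) \<le> (\<Sum>j\<in>?C - {h}. len I j - D j) + (len I h - D h)"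
      using finC by (cases "h \<in> ?C") (simp_all add: sum.remove)
    also have "\<dots> < (\<Sum>j\<in>?C - {h}. len I j - D0 j) + (len I h - D0 h)"
    proof -
      have "(\<Sum>j\<in>?C - {h}. len I j - D j) \<le> (\<Sum>j\<in>?C - {h}. len I j - D0 j)"
        by (rule sum_mono) (use le C in \<open>auto intro!: diff_le_mono2\<close>)
      then show ?thesis using h by linarith
    qed
    also have "\<dots> = (\<Sum>j\<in>?C'. len I j - D0 j)"
      using finC by (simp add: sum.insert_remove)
    finally show ?thesis
      using short[unfolded short_def, THEN conjunct2, rule_format, OF C'] eq by linarith
  qed
  note chain = this
  have K: "finite K" "card (insert t K) \<le> Suc (card K)"
    using short by (auto simp: short_def card_insert_if)
  have "(\<Sum>j\<in>C. len I j - D j) + card (insert t K) \<le> max_chain I"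
    if "C \<subseteq> jobs I" "totalp_on C (prec I)" for C
    using chain[OF that] K(2) by linarith
  then show ?thesis
    using K(1) by (simp add: short_def)
qed

section \<open>Counting the discarded tasks\<close>

lemma few_discarded:
  assumes core: "core I K (Suc (horizon I)) D D M SL"
    and fill: "(\<exists>j\<in>jobs I. D j < len I j) \<Longrightarrow> filled I K (Suc (horizon I)) D M SL"
    and short: "short I K D" and S: "window_assignment I S"
  shows "card {a \<in> tasks I. place M SL a \<notin> available I} \<le> num_machines I * max_chain I"
proof -
  let ?V = "advanced I D" and ?X = "{a \<in> tasks I. place M SL a \<notin> available I}"
  have av: "available I \<subseteq> machines I \<times> slots I" by (auto simp: available_def)
  then have finA: "finite (available I)"
    by (rule finite_subset) (simp add: machines_def slots_def)
  \<comment> \<open>The empty chain has sum 0, so the potential bounds \<open>card K\<close>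
    itself.\<close>
  have finK: "finite K" and K: "card K \<le> max_chain I"
    using short spec[of "\<lambda>C. C \<subseteq> jobs I \<longrightarrow> totalp_on C (prec I) \<longrightarrow>
      (\<Sum>j\<in>C. len I j - D j) + card K \<le> max_chain I" "{}"]
    unfolding short_def by (simp_all add: totalp_on_def)
  have cM: "card (machines I \<times> K) = num_machines I * card K"
    by (simp add: card_cartesian_product machines_def)
  have finM: "finite (machines I \<times> K)"
    using finK by (simp add: machines_def)
  have finT: "finite (tasks I)"
    by (simp add: tasks_def job_tasks_def)
  have inj: "inj_on (place M SL) ?V" using core by (simp add: core_def)
  have VT: "?V \<subseteq> tasks I"
    using core by (fastforce simp: core_def advanced_def tasks_def job_tasks_def)
  have "card ?X \<le> card (machines I \<times> K)"
  proof (cases "\<exists>j\<in>jobs I. D j < len I j")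
    case False
    then have "tasks I \<subseteq> ?V"
      by (force simp: advanced_def tasks_def job_tasks_def)
    then have X: "?X \<subseteq> ?V" by auto
    have "place M SL a \<in> machines I \<times> K" if "a \<in> ?X" for a
    proof -
      have a: "a \<in> ?V" "place M SL a \<notin> available I" using that X by auto
      then have "snd (place M SL a) \<in> K" using core by (simp add: core_def)
      moreover have "fst (place M SL a) \<in> machines I"
        using core a(1) by (fastforce simp: core_def advanced_def place_def machines_def)
      ultimately show ?thesis by (simp add: mem_Times_iff)
    qed
    then show ?thesis
      using card_inj_on_le[of "place M SL" ?X] inj_on_subset[OF inj X] finM by blast
  next
    case True
    let ?Y = "{a \<in> tasks I. place M SL a \<in> available I}"
    \<comment> \<open>Unconsumed tasks keep slot 0, and slots start at 1; so every task at an
      available pair has been consumed.\<close>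
    have "SL k j = 0" if "(k, j) \<in> tasks I" "(k, j) \<notin> ?V" for k j
      using that core by (auto simp: core_def tasks_def job_tasks_def advanced_def)
    then have Y: "?Y \<subseteq> ?V"
      by (fastforce simp: place_def available_def slots_def)
    have "card (tasks I) \<le> card (available I)"
      using S finA by (auto simp: window_assignment_def intro: card_inj_on_le)
    \<comment> \<open>\<open>?X\<close> holds lost tasks and never consumed ones together, so the
      available pairs left free by \<open>?Y\<close> bound both at once.\<close>
    moreover have "card (tasks I) = card ?X + card ?Y"
      using finT by (subst card_Un_disjoint[symmetric]) (auto intro: arg_cong[where f = card])
    moreover have "card ?Y = card (place M SL ` ?Y)"
      using inj_on_subset[OF inj Y] by (simp add: card_image)
    moreover have "card (available I) - card (place M SL ` ?Y) \<le> card (available I - place M SL ` ?Y)"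
      using finT by (intro diff_card_le_card_Diff) simp
    moreover have "available I - place M SL ` ?Y \<subseteq> machines I \<times> K"
    proof
      fix x assume x: "x \<in> available I - place M SL ` ?Y"
      obtain i u where iu: "x = (i, u)" by (cases x)
      have "i \<in> machines I" "u < Suc (horizon I)" using x iu by (auto simp: available_def slots_def)
      moreover have "x \<notin> place M SL ` ?V"
        using x VT by blast
      ultimately show "x \<in> machines I \<times> K"
        using fill[OF True] x iu by (auto simp: filled_def)
    qed
    then have "card (available I - place M SL ` ?Y) \<le> card (machines I \<times> K)"
      by (rule card_mono[OF finM])
    ultimately show ?thesis by linarith
  qed
  also have "\<dots> \<le> num_machines I * max_chain I"
    unfolding cM using K by (rule mult_le_mono2)
  finally show ?thesis .
qed

text \<open>Unconsumed tasks sit at slot 0, which is never available, and thus lie in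
  \<open>X\<close>; the remaining ones inherit injectivity and order from the core
  invariant.\<close>

lemma good_placement:
  assumes core: "core I K t D D M SL"
    and X: "X = {a \<in> tasks I. place M SL a \<notin> available I}"
    and P: "\<And>a. a \<in> tasks I \<Longrightarrow> P a = place M SL a"
  shows "good_schedule I X P"
proof -
  have "SL k j = 0" if "(k, j) \<in> tasks I" "(k, j) \<notin> advanced I D" for k j
    using that core by (auto simp: core_def tasks_def job_tasks_def advanced_def)
  then have "tasks I - X \<subseteq> advanced I D"
    unfolding X by (fastforce simp: place_def available_def slots_def)
  moreover have "inj_on P (tasks I - X) = inj_on (place M SL) (tasks I - X)"
    by (rule inj_on_cong) (simp add: P)
  moreover have "fst (P a) = M j" if "j \<in> jobs I" "a \<in> job_tasks I j" for a j
    using that P[of a] by (auto simp: tasks_def job_tasks_def place_def)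
  ultimately show ?thesis
    using core inj_on_subset[of "place M SL" "advanced I D" "tasks I - X"]
    unfolding good_schedule_def core_def by (intro conjI) (auto simp: X P subset_iff)
qed


section \<open>The two phases of a step: serving machines, then catching up\<close>

definition ready :: "inst \<Rightarrow> (nat \<Rightarrow> nat) \<Rightarrow> nat \<Rightarrow> bool" where
  "ready I D j \<longleftrightarrow> (\<forall>h\<in>jobs I. prec I h j \<longrightarrow> \<not> D h < len I h)"

definition unfinished :: "inst \<Rightarrow> (nat \<Rightarrow> nat) \<Rightarrow> bool" where
  "unfinished I D \<longleftrightarrow> (\<exists>j\<in>jobs I. D j < len I j)"

text \<open>\<open>K\<close> is a ghost variable. \<open>filled\<close> is demanded only while work
  remains, since later idle steps do not enter \<open>K\<close> and may leave slots empty.\<close>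

definition sched_inv :: "inst \<Rightarrow> nat \<Rightarrow> (nat \<Rightarrow> nat) \<Rightarrow> (nat \<Rightarrow> nat) \<Rightarrow> (nat \<Rightarrow> nat \<Rightarrow> nat) \<Rightarrow> bool" where
  "sched_inv I t D M SL \<longleftrightarrow> (\<exists>K. core I K t D D M SL \<and> short I K D \<and>
     (unfinished I D \<longrightarrow> filled I K t D M SL))"

text \<open>Describes step \<open>t\<close> after the machines up to \<open>i\<close>. An idle
  machine testifies that every ready unfinished job has been started, and this persists: readiness
  refers to \<open>D0\<close>, and a started job stays started. Without an idle machine, every
  available pair so far is occupied.\<close>

definition machine_inv :: "inst \<Rightarrow> nat set \<Rightarrow> nat \<Rightarrow> (nat \<Rightarrow> nat) \<Rightarrow> nat \<Rightarrow> bool \<Rightarrow> (nat \<Rightarrow> nat) \<Rightarrow>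
    (nat \<Rightarrow> nat) \<Rightarrow> (nat \<Rightarrow> nat \<Rightarrow> nat) \<Rightarrow> bool" where
  "machine_inv I K t D0 i idle D M SL \<longleftrightarrow>
     core I K t D0 D M SL \<and>
     (\<forall>j\<in>jobs I. D j \<noteq> D0 j \<longrightarrow> M j \<le> i \<and> (M j, t) \<in> available I) \<and>
     (\<forall>j\<in>jobs I. D0 j < len I j \<longrightarrow> M j \<le> i \<longrightarrow> (M j, t) \<in> available I \<longrightarrow> D0 j < D j) \<and>
     (if idle then \<forall>j\<in>jobs I. D0 j < len I j \<longrightarrow> ready I D0 j \<longrightarrow> M j \<noteq> 0
      else \<forall>i'\<le>i. (i', t) \<in> available I \<longrightarrow> (i', t) \<in> place M SL ` advanced I D) \<and>
     (unfinished I D0 \<longrightarrow> filled I K t D M SL)"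

text \<open>Describes step \<open>t\<close> after the jobs up to \<open>x\<close> have been
  inspected. \<open>t\<close> joins \<open>K\<close> only if some job was unfinished before the
  step, as otherwise no chain gets shorter. The equation \<open>D j = D0 j\<close> for jobs still to
  be inspected ensures that none moves twice.\<close>

definition catchup_inv :: "inst \<Rightarrow> nat set \<Rightarrow> nat \<Rightarrow> (nat \<Rightarrow> nat) \<Rightarrow> nat \<Rightarrow> (nat \<Rightarrow> nat) \<Rightarrow>
    (nat \<Rightarrow> nat) \<Rightarrow> (nat \<Rightarrow> nat \<Rightarrow> nat) \<Rightarrow> bool" where
  "catchup_inv I K t D0 x D M SL \<longleftrightarrow>
     core I (if unfinished I D0 then insert t K else K) t D0 D M SL \<and>
     (\<forall>j\<in>jobs I. D0 j < len I j \<longrightarrow> M j \<noteq> 0 \<longrightarrow>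
        (if (M j, t) \<in> available I \<or> j \<le> x then D0 j < D j else D j = D0 j)) \<and>
     (\<forall>j\<in>jobs I. D0 j < len I j \<longrightarrow> ready I D0 j \<longrightarrow> M j \<noteq> 0) \<and>
     (unfinished I D0 \<longrightarrow> filled I K t D M SL)"

lemma available_pos: "(i, t) \<in> available I \<Longrightarrow> i \<noteq> 0 \<and> t \<noteq> 0"
  by (auto simp: available_def machines_def slots_def)

lemma filled_mono:
  "filled I K t D M SL \<Longrightarrow> place M SL ` advanced I D \<subseteq> place M' SL' ` advanced I D' \<Longrightarrow>
    K \<subseteq> K' \<Longrightarrow> filled I K' t D' M' SL'"
  unfolding filled_def by blast

lemma machine_inv_init:
  assumes "core I K t D D M SL" "unfinished I D \<longrightarrow> filled I K t D M SL"
  shows "machine_inv I K t D 0 False D M SL"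
  using assms available_pos by (auto simp: machine_inv_def)

lemma machine_inv_unavailable:
  assumes "machine_inv I K t D0 i idle D M SL" "(Suc i, t) \<notin> available I"
  shows "machine_inv I K t D0 (Suc i) idle D M SL"
  using assms unfolding machine_inv_def by (auto simp: le_Suc_eq)

text \<open>The search reads the current \<open>D\<close> while the invariant speaks of
  \<open>D0\<close>. For the jobs concerned both agree, because so far only jobs on available
  machines up to \<open>i\<close> have moved.\<close>

lemma machine_inv_idle:
  assumes inv: "machine_inv I K t D0 i idle D M SL"
    and none: "\<And>j. j \<in> jobs I \<Longrightarrow> D j < len I j \<Longrightarrow> M j \<noteq> Suc i \<and> \<not> (M j = 0 \<and> ready I D0 j)"
  shows "machine_inv I K t D0 (Suc i) True D M SL"
proof -
  have D: "D j = D0 j" if "j \<in> jobs I" "M j = 0 \<or> M j = Suc i" for j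
    using that inv available_pos unfolding machine_inv_def by fastforce
  then have "M j \<noteq> Suc i \<and> \<not> (M j = 0 \<and> ready I D0 j)" if "j \<in> jobs I" "D0 j < len I j" for j
    using none[OF that(1)] that by metis
  then show ?thesis
    using inv unfolding machine_inv_def by (auto simp: le_Suc_eq)
qed

text \<open>The alternatives for \<open>M c\<close> are continuing and starting a job. Exclusivity
  makes \<open>c\<close> the only job on machine \<open>Suc i\<close> that was unfinished before the
  step, so moving it settles that machine.\<close>

lemma machine_inv_run:
  assumes inv: "machine_inv I K t D0 i idle D M SL" and irr: "irreflp_on (jobs I) (prec I)"
    and av: "(Suc i, t) \<in> available I"
    and c: "c \<in> jobs I" "D c < len I c"
    and M: "M c = Suc i \<or> M c = 0 \<and> ready I D0 c \<and> (\<forall>j\<in>jobs I. D j < len I j \<longrightarrow> M j \<noteq> Suc i)"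
  shows "machine_inv I K t D0 (Suc i) idle (D(c := Suc (D c))) (M(c := Suc i))
    (SL(Suc (D c) := (SL (Suc (D c)))(c := t)))"
proof -
  have core: "core I K t D0 D M SL"
    and I2: "\<And>j. j \<in> jobs I \<Longrightarrow> D j \<noteq> D0 j \<Longrightarrow> M j \<le> i \<and> (M j, t) \<in> available I"
    and I3: "\<And>j. j \<in> jobs I \<Longrightarrow> D0 j < len I j \<Longrightarrow> M j \<le> i \<Longrightarrow> (M j, t) \<in> available I \<Longrightarrow> D0 j < D j"
    and I4: "if idle then \<forall>j\<in>jobs I. D0 j < len I j \<longrightarrow> ready I D0 j \<longrightarrow> M j \<noteq> 0
      else \<forall>i'\<le>i. (i', t) \<in> available I \<longrightarrow> (i', t) \<in> place M SL ` advanced I D"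
    and I5: "unfinished I D0 \<Longrightarrow> filled I K t D M SL"
    using inv unfolding machine_inv_def by blast+
  \<comment> \<open>Machine 0 is never available, so an unstarted job cannot have moved
    either.\<close>
  have D: "D j = D0 j" if "j \<in> jobs I" "M j = 0 \<or> M j = Suc i" for j
    using I2[OF that(1)] that(2) available_pos[of 0 t I] by (cases "D j = D0 j") auto
  have le: "D0 j \<le> D j" "D j \<le> len I j" if "j \<in> jobs I" for j
    using core that by (simp_all add: core_def)
  have C2: "j = j'" if "j \<in> jobs I" "j' \<in> jobs I" "D0 j < len I j" "D0 j' < len I j'" "M j = M j'"
    "M j \<noteq> 0" for j j'
    using core that unfolding core_def by blast
  have Dc: "D c = D0 c" using D[OF c(1)] M by blast
  have i: "Suc i \<in> machines I" "0 < t" using av available_pos by (auto simp: available_def)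
  have M': "M c = Suc i \<or> M c = 0 \<and> (\<forall>j\<in>jobs I. D0 j < len I j \<longrightarrow> M j \<noteq> Suc i) \<and>
      (\<forall>h\<in>jobs I. prec I h c \<longrightarrow> D0 h = len I h)"
  proof (cases "M c = Suc i")
    case False
    have "D0 h = len I h" if "h \<in> jobs I" "prec I h c" for h
      using M False that le[OF that(1)] by (fastforce simp: ready_def)
    moreover have "M j \<noteq> Suc i" if "j \<in> jobs I" "D0 j < len I j" for j
    proof
      assume "M j = Suc i"
      then show False using M False that D[OF that(1)] by simp
    qed
    ultimately show ?thesis using M False by blast
  qed simp
  note adv = core_advance[OF core irr c(1) Dc c(2) i M' disjI1[OF av]]
  have only: "j = c" if "j \<in> jobs I" "D0 j < len I j" "M j = Suc i" for j
    using M' C2[OF that(1) c(1)] that c(2) Dc by auto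
  show ?thesis
    unfolding machine_inv_def
  proof (intro conjI)
    show "if idle then \<forall>j\<in>jobs I. D0 j < len I j \<longrightarrow> ready I D0 j \<longrightarrow> (M(c := Suc i)) j \<noteq> 0
      else \<forall>i'\<le>Suc i. (i', t) \<in> available I \<longrightarrow> (i', t) \<in> place (M(c := Suc i))
        (SL(Suc (D c) := (SL (Suc (D c)))(c := t))) ` advanced I (D(c := Suc (D c)))"
      unfolding adv(2) using I4 by (cases idle) (simp_all add: le_Suc_eq)
    show "unfinished I D0 \<longrightarrow> filled I K t (D(c := Suc (D c))) (M(c := Suc i))
        (SL(Suc (D c) := (SL (Suc (D c)))(c := t)))"
      by (intro impI filled_mono[OF I5 _ subset_refl]) (simp_all only: adv(2) subset_insertI)
    show "\<forall>j\<in>jobs I. (D(c := Suc (D c))) j \<noteq> D0 j \<longrightarrow>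
        (M(c := Suc i)) j \<le> Suc i \<and> ((M(c := Suc i)) j, t) \<in> available I"
      using I2 av by (simp add: le_SucI)
    show "\<forall>j\<in>jobs I. D0 j < len I j \<longrightarrow> (M(c := Suc i)) j \<le> Suc i \<longrightarrow>
        ((M(c := Suc i)) j, t) \<in> available I \<longrightarrow> D0 j < (D(c := Suc (D c))) j"
    proof (intro ballI impI)
      fix j assume j: "j \<in> jobs I" "D0 j < len I j" "(M(c := Suc i)) j \<le> Suc i"
        "((M(c := Suc i)) j, t) \<in> available I"
      show "D0 j < (D(c := Suc (D c))) j"
      proof (cases "j = c")
        case False
        then have "M j \<noteq> Suc i" using only[OF j(1,2)] by blast
        then show ?thesis using False j I3[OF j(1,2)] by (simp add: le_Suc_eq)
      qed (simp add: Dc)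
    qed
  qed (fact adv(1))
qed

text \<open>Every available pair at \<open>t\<close> is occupied, so \<open>filled\<close> extends
  to \<open>Suc t\<close> with the same \<open>K\<close>.\<close>

lemma sched_inv_busy:
  assumes inv: "machine_inv I K t D0 (num_machines I) False D M SL" and short: "short I K D0"
  shows "sched_inv I (Suc t) D M SL"
proof -
  have core: "core I K t D0 D M SL" using inv by (simp add: machine_inv_def)
  have le: "D0 j \<le> D j" if "j \<in> jobs I" for j
    using core that by (simp add: core_def)
  have "(\<Sum>j\<in>C. len I j - D j) \<le> (\<Sum>j\<in>C. len I j - D0 j)" if "C \<subseteq> jobs I" for C
    using le that by (intro sum_mono diff_le_mono2) auto
  then have "short I K D"
    using short unfolding short_def by (meson add_le_mono1 le_trans)
  moreover have "filled I K (Suc t) D M SL" if "unfinished I D"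
  proof -
    have "unfinished I D0" using that le unfolding unfinished_def by (meson le_less_trans)
    then have "filled I K t D M SL" using inv by (simp add: machine_inv_def)
    moreover have "i \<le> num_machines I" if "(i, t) \<in> available I" for i
      using that by (auto simp: available_def machines_def)
    ultimately show ?thesis
      using inv unfolding filled_def machine_inv_def by (auto simp: less_Suc_eq)
  qed
  ultimately show ?thesis
    unfolding sched_inv_def using core_next[OF core] by blast
qed

lemma catchup_inv_init:
  assumes "machine_inv I K t D0 (num_machines I) True D M SL"
  shows "catchup_inv I K t D0 0 D M SL"
proof -
  have core: "core I K t D0 D M SL" using assms by (simp add: machine_inv_def)
  have "M j \<le> num_machines I" if "j \<in> jobs I" for j
    using core that by (simp add: core_def)
  moreover have "j \<noteq> 0" if "j \<in> jobs I" for j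
    using that by (simp add: jobs_def)
  moreover have "core I (if unfinished I D0 then insert t K else K) t D0 D M SL"
    using core_mono[OF core] by auto
  ultimately show ?thesis
    using assms unfolding machine_inv_def catchup_inv_def by auto
qed

lemma catchup_inv_skip:
  assumes inv: "catchup_inv I K t D0 x D M SL"
    and "\<not> (D (Suc x) < len I (Suc x) \<and> M (Suc x) \<noteq> 0 \<and> (M (Suc x), t) \<notin> available I)"
  shows "catchup_inv I K t D0 (Suc x) D M SL"
proof -
  have "D0 j < D j" if j: "j \<in> jobs I" "j = Suc x" "D0 j < len I j" "M j \<noteq> 0"
  for j
  proof (cases "(M j, t) \<in> available I")
    case True
    then show ?thesis using inv j unfolding catchup_inv_def by auto
  next
    case False
    then have "D j = D0 j" using inv j unfolding catchup_inv_def by auto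
    then show ?thesis using assms(2) False j by auto
  qed
  then show ?thesis
    using inv unfolding catchup_inv_def by (auto simp: le_Suc_eq)
qed

lemma catchup_inv_advance:
  assumes inv: "catchup_inv I K t D0 x D M SL" and irr: "irreflp_on (jobs I) (prec I)"
    and c: "c = Suc x" "c \<in> jobs I" "D c < len I c" "M c \<noteq> 0" "(M c, t) \<notin> available I"
    and t: "0 < t"
  shows "catchup_inv I K t D0 (Suc x) (D(c := Suc (D c))) M
    (SL(Suc (D c) := (SL (Suc (D c)))(c := t)))"
proof -
  let ?K = "if unfinished I D0 then insert t K else K"
  have core: "core I ?K t D0 D M SL" using inv by (simp add: catchup_inv_def)
  have le: "D0 c \<le> D c" "M c \<le> num_machines I"
    using core c(2) by (simp_all add: core_def)
  then have D0: "D0 c < len I c" using c by simp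
  then have Dc: "D c = D0 c" using inv c unfolding catchup_inv_def by auto
  \<comment> \<open>\<open>c\<close> itself witnesses that a job was unfinished before the
    step.\<close>
  have "t \<in> ?K" using D0 c(2) by (auto simp: unfinished_def)
  moreover have "M c \<in> machines I" using c le by (auto simp: machines_def)
  ultimately have adv:
    "core I ?K t D0 (D(c := Suc (D c))) M (SL(Suc (D c) := (SL (Suc (D c)))(c := t)))"
    "place M (SL(Suc (D c) := (SL (Suc (D c)))(c := t))) ` advanced I (D(c := Suc (D c))) =
      insert (M c, t) (place M SL ` advanced I D)"
    using core_advance[OF core irr c(2) Dc c(3) _ t, of "M c"] by simp_all
  have fill: "unfinished I D0 \<Longrightarrow> filled I K t D M SL"
    using inv by (simp add: catchup_inv_def)
  have "unfinished I D0 \<longrightarrow> filled I K t (D(c := Suc (D c))) M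
      (SL(Suc (D c) := (SL (Suc (D c)))(c := t)))"
    by (intro impI filled_mono[OF fill _ subset_refl]) (simp_all only: adv(2) subset_insertI)
  moreover have "\<forall>j\<in>jobs I. D0 j < len I j \<longrightarrow> M j \<noteq> 0 \<longrightarrow>
      (if (M j, t) \<in> available I \<or> j \<le> Suc x then D0 j < (D(c := Suc (D c))) j
       else (D(c := Suc (D c))) j = D0 j)"
  proof (intro ballI impI)
    fix j assume j: "j \<in> jobs I" "D0 j < len I j" "M j \<noteq> 0"
    then have "if (M j, t) \<in> available I \<or> j \<le> x then D0 j < D j else D j = D0 j"
      using inv by (simp add: catchup_inv_def)
    then show "if (M j, t) \<in> available I \<or> j \<le> Suc x then D0 j < (D(c := Suc (D c))) j
       else (D(c := Suc (D c))) j = D0 j"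
      using Dc c(1) by (cases "j = c") (simp_all add: le_Suc_eq)
  qed
  ultimately show ?thesis
    using inv adv(1) unfolding catchup_inv_def by blast
qed

text \<open>After the full pass, every unfinished job with a machine has moved, and every ready one
  has a machine; this is the progress that \<open>short_step\<close> asks for. Empty slots at
  \<open>t\<close> are excused by \<open>t\<close> being in the enlarged \<open>K\<close>.\<close>

lemma sched_inv_catchup:
  assumes inv: "catchup_inv I K t D0 (num_jobs I) D M SL" and short: "short I K D0"
    and irr: "irreflp_on (jobs I) (prec I)" and tr: "transp_on (jobs I) (prec I)"
  shows "sched_inv I (Suc t) D M SL"
proof -
  let ?K = "if unfinished I D0 then insert t K else K"
  have core: "core I ?K t D0 D M SL" using inv by (simp add: catchup_inv_def)
  have le: "D0 j \<le> D j" "D j \<le> len I j" if "j \<in> jobs I" for j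
    using core that by (simp_all add: core_def)
  have step: "D0 j < D j" if "j \<in> jobs I" "D0 j < len I j"
    "\<And>h. h \<in> jobs I \<Longrightarrow> prec I h j \<Longrightarrow> \<not> D0 h < len I h" for j
  proof -
    have "ready I D0 j" "j \<le> num_jobs I" using that by (auto simp: ready_def jobs_def)
    moreover from this have "M j \<noteq> 0"
      using inv that(1,2) by (simp add: catchup_inv_def)
    ultimately show ?thesis using inv that(1,2) by (simp add: catchup_inv_def)
  qed
  have "short I ?K D"
  proof (cases "unfinished I D0")
    case True
    have "short I (insert t K) D"
      by (rule short_step[OF irr tr short _ True[unfolded unfinished_def]]) (fact le(1), fact step)
    then show ?thesis using True by simp
  next
    \<comment> \<open>All jobs were finished before the step, so nothing moved and \<open>K\<close>
      stays as it is.\<close>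
    case False
    then have "D j = D0 j" if "j \<in> jobs I" for j
      using le[OF that] that by (force simp: unfinished_def)
    then have "(\<Sum>j\<in>C. len I j - D j) = (\<Sum>j\<in>C. len I j - D0 j)" if "C \<subseteq> jobs I" for C
      using that by (intro sum.cong) auto
    then show ?thesis
      using False short unfolding short_def by simp
  qed
  moreover have "filled I ?K (Suc t) D M SL" if "unfinished I D"
  proof -
    have "unfinished I D0" using that le unfolding unfinished_def by (meson le_less_trans)
    moreover from this have "filled I K t D M SL" using inv by (simp add: catchup_inv_def)
    ultimately show ?thesis
      unfolding filled_def by (auto simp: less_Suc_eq)
  qed
  ultimately show ?thesis
    unfolding sched_inv_def using core_next[OF core] by blast
qed

lemma sched_inv_init: "sched_inv I (Suc 0) (\<lambda>j. 0) (\<lambda>j. 0) (\<lambda>k j. 0)"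
proof -
  have "advanced I (\<lambda>j. 0) = {}" by (auto simp: advanced_def)
  then have "core I {} (Suc 0) (\<lambda>j. 0) (\<lambda>j. 0) (\<lambda>j. 0) (\<lambda>k j. 0)"
    by (simp add: core_def)
  moreover have "filled I {} (Suc 0) (\<lambda>j. 0) (\<lambda>j. 0) (\<lambda>k j. 0)"
    by (auto simp: filled_def available_def slots_def)
  ultimately show ?thesis
    unfolding sched_inv_def using short_init by blast
qed

lemma sched_inv_final:
  assumes inv: "sched_inv I (Suc (horizon I)) D M SL" and S: "window_assignment I S"
    and X: "X = {a \<in> tasks I. place M SL a \<notin> available I}"
    and P: "\<And>a. a \<in> tasks I \<Longrightarrow> P a = place M SL a"
  shows "good_schedule I X P" "card X \<le> num_machines I * max_chain I"
proof -
  obtain K where K: "core I K (Suc (horizon I)) D D M SL" "short I K D"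
      "unfinished I D \<longrightarrow> filled I K (Suc (horizon I)) D M SL"
    using inv unfolding sched_inv_def by blast
  show "good_schedule I X P"
    using good_placement[OF K(1) X P] .
  show "card X \<le> num_machines I * max_chain I"
    unfolding X using few_discarded[OF K(1) _ K(2) S] K(3) by (auto simp: unfinished_def)
qed

section \<open>Running time and correctness of programs\<close>

text \<open>The time \<open>n\<close> is an upper bound, so that branches of different cost can
  share it.\<close>

definition wp :: "com \<Rightarrow> nat \<Rightarrow> (memory \<Rightarrow> bool) \<Rightarrow> memory \<Rightarrow> bool" where
  "wp c n Q s \<longleftrightarrow> (\<exists>k s'. exec c s k s' \<and> k \<le> n \<and> Q s')"

lemma wp_conseq: "wp c n Q s \<Longrightarrow> n \<le> n' \<Longrightarrow> (\<And>s'. Q s' \<Longrightarrow> Q' s') \<Longrightarrow> wp c n' Q' s"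
  unfolding wp_def by (meson le_trans)

lemma wp_skip: "Q s \<Longrightarrow> 1 \<le> n \<Longrightarrow> wp Skip n Q s"
  unfolding wp_def using exec.Skip by blast

lemma wp_assign: "Q (update s x (aval a s) (aval b s) (aval e s)) \<Longrightarrow> 1 \<le> n \<Longrightarrow> wp (Assign x a b e) n Q s"
  unfolding wp_def using exec.Assign by blast

lemma wp_seq: "wp c n (wp d n' Q) s \<Longrightarrow> wp (Seq c d) (n + n') Q s"
  unfolding wp_def using exec.Seq add_le_mono by metis

lemma wp_cond:
  "(bval b s \<Longrightarrow> wp c n Q s) \<Longrightarrow> (\<not> bval b s \<Longrightarrow> wp d n Q s) \<Longrightarrow> wp (Cond b c d) (n + 1) Q s"
  unfolding wp_def using exec.CondTrue exec.CondFalse add_le_mono1 by (cases "bval b s") metis+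

abbreviation Var :: "string \<Rightarrow> aexp" where
  "Var x \<equiv> Cell x (Num 0) (Num 0)"

abbreviation Elem :: "string \<Rightarrow> string \<Rightarrow> aexp" where
  "Elem x y \<equiv> Cell x (Var y) (Num 0)"

abbreviation Set :: "string \<Rightarrow> aexp \<Rightarrow> com" where
  "Set x e \<equiv> Assign x (Num 0) (Num 0) e"

text \<open>The counter is raised before the body, which thus sees 1 to N, in line with numbering
  from 1. The bound \<open>e\<close> is evaluated anew at each test.\<close>

definition For :: "string \<Rightarrow> aexp \<Rightarrow> com \<Rightarrow> com" where
  "For x e c = Seq (Set x (Num 0)) (While (Less (Var x) e) (Seq (Set x (Plus (Var x) (Num 1))) c))"

text \<open>A round costs the body plus one test and one increment; initialisation and the failing
  last test add 2. Through \<open>var\<close> the invariant itself guarantees that the body leaves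
  bound and counter intact.\<close>

lemma wp_for:
  assumes init: "Inv 0 (update s x 0 0 0)"
    and var: "\<And>k s. Inv k s \<Longrightarrow> aval e s = N \<and> s x 0 0 = k"
    and body: "\<And>k s. k < N \<Longrightarrow> Inv k s \<Longrightarrow> wp c n (Inv (Suc k)) (update s x 0 0 (Suc k))"
    and final: "\<And>s. Inv N s \<Longrightarrow> Q s"
  shows "wp (For x e c) (N * (n + 2) + 2) Q s"
proof -
  let ?b = "Less (Var x) e" and ?c = "Seq (Set x (Plus (Var x) (Num 1))) c"
  have "wp (While ?b ?c) (d * (n + 2) + 1) (Inv N) s" if "k + d = N" "Inv k s" for d k s
    using that
  proof (induction d arbitrary: k s)
    case 0
    then have "\<not> bval ?b s" using var[OF 0(2)] by simp
    then show ?case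
      unfolding wp_def using exec.WhileFalse[of ?b s] 0 by fastforce
  next
    case (Suc d)
    have b: "bval ?b s" using var[OF Suc.prems(2)] Suc.prems(1) by simp
    obtain n1 s1 where 1: "exec c (update s x 0 0 (Suc k)) n1 s1" "n1 \<le> n" "Inv (Suc k) s1"
      using body[OF _ Suc.prems(2)] Suc.prems(1) unfolding wp_def by auto
    have "exec ?c s (1 + n1) s1"
      using exec.Seq[OF exec.Assign[of x "Num 0" "Num 0" "Plus (Var x) (Num 1)" s]] 1(1)
        var[OF Suc.prems(2)] by simp
    moreover obtain n2 s2 where 2: "exec (While ?b ?c) s1 n2 s2" "n2 \<le> d * (n + 2) + 1" "Inv N s2"
      using Suc.IH[OF _ 1(3)] Suc.prems(1) unfolding wp_def by auto
    ultimately have "exec (While ?b ?c) s (1 + n1 + n2 + 1) s2"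
      using exec.WhileTrue[OF b] by blast
    moreover have "1 + n1 + n2 + 1 \<le> Suc d * (n + 2) + 1"
      using 1(2) 2(2) by simp
    ultimately show ?case using 2(3) unfolding wp_def by blast
  qed
  from this[of 0 N, OF _ init] have "wp (While ?b ?c) (N * (n + 2) + 1) Q (update s x 0 0 0)"
    by (rule wp_conseq) (use final in auto)
  then have "wp (For x e c) (1 + (N * (n + 2) + 1)) Q s"
    unfolding For_def by (intro wp_seq wp_assign) simp_all
  then show ?thesis by simp
qed

section \<open>Frame conditions and search loops\<close>

definition agree :: "string set \<Rightarrow> memory \<Rightarrow> memory \<Rightarrow> bool" where
  "agree X s s' \<longleftrightarrow> (\<forall>x. x \<notin> X \<longrightarrow> s' x = s x)"

lemma agreeD: "agree X s s' \<Longrightarrow> x \<notin> X \<Longrightarrow> s' x = s x"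
  by (simp add: agree_def)

lemma agree_refl: "agree X s s"
  by (simp add: agree_def)

lemma agree_trans: "agree X s s' \<Longrightarrow> agree X s' s'' \<Longrightarrow> agree X s s''"
  unfolding agree_def by simp

lemma agree_mono: "agree X s s' \<Longrightarrow> X \<subseteq> Y \<Longrightarrow> agree Y s s'"
  unfolding agree_def by (simp add: subset_iff) metis

lemma agree_update: "agree X s s' \<Longrightarrow> x \<in> X \<Longrightarrow> agree X s (update s' x a b v)"
  unfolding agree_def update_def by auto

lemma update_same [simp]: "update s x a b v x c d = (if c = a \<and> d = b then v else s x c d)"
  by (simp add: update_def)

lemma update_other [simp]: "y \<noteq> x \<Longrightarrow> update s x a b v y = s y"
  by (simp add: update_def)

text \<open>The last match wins, and without a match \<open>c\<close> keeps its value; hence two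
  selections in a row give priority to the second.\<close>

definition select :: "bexp \<Rightarrow> com" where
  "select b = For ''j'' (Var ''jobs'') (Cond b (Set ''c'' (Var ''j'')) Skip)"

lemma wp_select:
  assumes N: "s ''jobs'' 0 0 = N"
    and b: "\<And>s'. agree {''c'', ''j''} s s' \<Longrightarrow> s' ''j'' 0 0 \<in> {1..N} \<Longrightarrow> bval b s' = B (s' ''j'' 0 0)"
  shows "wp (select b) (4 * N + 2) (\<lambda>s'. agree {''c'', ''j''} s s' \<and>
    (if \<exists>j\<in>{1..N}. B j then s' ''c'' 0 0 \<in> {1..N} \<and> B (s' ''c'' 0 0)
     else s' ''c'' 0 0 = s ''c'' 0 0)) s"
proof -
  define Inv where "Inv k s' \<longleftrightarrow> s' ''j'' 0 0 = k \<and> agree {''c'', ''j''} s s' \<and>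
    (if \<exists>j\<in>{1..k}. B j then s' ''c'' 0 0 \<in> {1..k} \<and> B (s' ''c'' 0 0)
     else s' ''c'' 0 0 = s ''c'' 0 0)" for k s'
  have "wp (select b) (N * ((1 + 1) + 2) + 2) (\<lambda>s'. agree {''c'', ''j''} s s' \<and>
    (if \<exists>j\<in>{1..N}. B j then s' ''c'' 0 0 \<in> {1..N} \<and> B (s' ''c'' 0 0)
     else s' ''c'' 0 0 = s ''c'' 0 0)) s"
    unfolding select_def
  proof (rule wp_for[where Inv = Inv])
    show "Inv 0 (update s ''j'' 0 0 0)"
      by (simp add: Inv_def agree_refl agree_update)
    show "aval (Var ''jobs'') s' = N \<and> s' ''j'' 0 0 = k" if "Inv k s'" for k s'
      using that N agreeD[of "{''c'', ''j''}" s s' "''jobs''"] by (simp add: Inv_def)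
    show "wp (Cond b (Set ''c'' (Var ''j'')) Skip) (1 + 1) (Inv (Suc k)) (update s' ''j'' 0 0 (Suc k))"
      if "k < N" "Inv k s'" for k s'
    proof -
      let ?s = "update s' ''j'' 0 0 (Suc k)"
      have ag: "agree {''c'', ''j''} s ?s" using that by (simp add: Inv_def agree_update)
      have "bval b ?s = B (Suc k)" using b[OF ag] that by simp
      moreover have "{1..Suc k} = insert (Suc k) {1..k}" by auto
      ultimately show ?thesis
        using that ag by (intro wp_cond wp_assign wp_skip) (auto simp: Inv_def agree_update split: if_splits)
    qed
  qed (unfold Inv_def, elim conjE, intro conjI)
  then show ?thesis by (rule wp_conseq) simp
qed

section \<open>The scheduling program\<close>

definition dn :: "memory \<Rightarrow> nat \<Rightarrow> nat" where "dn s j = s ''done'' j 0"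
definition mc :: "memory \<Rightarrow> nat \<Rightarrow> nat" where "mc s j = s ''mach'' j 0"

text \<open>The clause on \<open>cap\<close> ranges over all indices: cells outside the table are 0,
  so a single test also rejects machine 0 and slot 0, the marks of unstarted jobs and unconsumed
  tasks.\<close>

definition holds :: "inst \<Rightarrow> memory \<Rightarrow> bool" where
  "holds I s \<longleftrightarrow> s ''machines'' 0 0 = num_machines I \<and> s ''horizon'' 0 0 = horizon I \<and>
     s ''jobs'' 0 0 = num_jobs I \<and> (\<forall>j\<in>jobs I. s ''len'' j 0 = len I j) \<and>
     (\<forall>h\<in>jobs I. \<forall>j\<in>jobs I. s ''prec'' h j = of_bool (prec I h j)) \<and>
     (\<forall>i t. s ''cap'' i t = 1 \<longleftrightarrow> (i, t) \<in> available I)"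

lemma holds_input: "holds I (input I)"
proof -
  have "input I ''cap'' i t = (if i \<in> machines I \<and> t \<in> slots I then cap I i t else 0)" for i t
    by (simp add: input_def)
  then have "input I ''cap'' i t = 1 \<longleftrightarrow> (i, t) \<in> available I" for i t
    unfolding available_def by auto
  moreover have "j \<in> jobs I \<Longrightarrow> input I ''len'' j 0 = len I j"
      "h \<in> jobs I \<Longrightarrow> j \<in> jobs I \<Longrightarrow> input I ''prec'' h j = of_bool (prec I h j)" for h j
    by (simp_all add: input_def)
  moreover have "input I ''machines'' 0 0 = num_machines I" "input I ''horizon'' 0 0 = horizon I"
      "input I ''jobs'' 0 0 = num_jobs I"
    by (simp_all add: input_def)
  ultimately show ?thesis
    unfolding holds_def by (intro conjI ballI allI)
qed

lemma holds_agree: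
  assumes "holds I s" "agree X s s'"
    "''machines'' \<notin> X" "''horizon'' \<notin> X" "''jobs'' \<notin> X" "''len'' \<notin> X" "''prec'' \<notin> X" "''cap'' \<notin> X"
  shows "holds I s'"
  using assms(1) unfolding holds_def assms(3-8)[THEN agreeD[OF assms(2)]] .

text \<open>Runs before any machine is served, so \<open>ok\<close> freezes readiness with respect
  to \<open>D0\<close>.\<close>

definition find_ready :: com where
  "find_ready = For ''j'' (Var ''jobs'') (Seq (Assign ''ok'' (Var ''j'') (Num 0) (Num 1))
     (For ''h'' (Var ''jobs'')
       (Cond (And (Equal (Cell ''prec'' (Var ''h'') (Var ''j'')) (Num 1)) (Less (Elem ''done'' ''h'') (Elem ''len'' ''h'')))
         (Assign ''ok'' (Var ''j'') (Num 0) (Num 0)) Skip)))"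

lemma wp_find_ready:
  assumes I: "holds I s"
  shows "wp find_ready (num_jobs I * (4 * num_jobs I + 5) + 2) (\<lambda>s'. agree {''ok'', ''j'', ''h''} s s' \<and>
    (\<forall>j\<in>jobs I. s' ''ok'' j 0 = 1 \<longleftrightarrow> ready I (dn s) j)) s"
proof -
  let ?N = "num_jobs I" and ?X = "{''ok'', ''j'', ''h''}"
  define Inv where "Inv k s' \<longleftrightarrow> s' ''j'' 0 0 = k \<and> agree ?X s s' \<and>
    (\<forall>j\<in>{1..k}. s' ''ok'' j 0 = 1 \<longleftrightarrow> ready I (dn s) j)" for k s'
  define Inv2 where "Inv2 k k' s' \<longleftrightarrow> s' ''h'' 0 0 = k' \<and> s' ''j'' 0 0 = Suc k \<and> agree ?X s s' \<and>
    (\<forall>j\<in>{1..k}. s' ''ok'' j 0 = 1 \<longleftrightarrow> ready I (dn s) j) \<and>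
    (s' ''ok'' (Suc k) 0 = 1 \<longleftrightarrow> (\<forall>h\<in>{1..k'}. prec I h (Suc k) \<longrightarrow> \<not> dn s h < len I h))" for k k' s'
  have jobs: "s' ''jobs'' 0 0 = ?N" if "agree ?X s s'" for s'
    using I agreeD[OF that, of "''jobs''"] by (simp add: holds_def)
  have "wp find_ready (?N * ((1 + (?N * ((1 + 1) + 2) + 2)) + 2) + 2) (\<lambda>s'. agree ?X s s' \<and>
    (\<forall>j\<in>jobs I. s' ''ok'' j 0 = 1 \<longleftrightarrow> ready I (dn s) j)) s"
    unfolding find_ready_def
  proof (rule wp_for[where Inv = Inv])
    show "Inv 0 (update s ''j'' 0 0 0)"
      by (simp add: Inv_def agree_refl agree_update)
    show "aval (Var ''jobs'') s' = ?N \<and> s' ''j'' 0 0 = k" if "Inv k s'" for k s'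
      using that jobs by (simp add: Inv_def)
    show "wp (Seq (Assign ''ok'' (Var ''j'') (Num 0) (Num 1)) (For ''h'' (Var ''jobs'')
        (Cond (And (Equal (Cell ''prec'' (Var ''h'') (Var ''j'')) (Num 1)) (Less (Elem ''done'' ''h'') (Elem ''len'' ''h'')))
         (Assign ''ok'' (Var ''j'') (Num 0) (Num 0)) Skip))) (1 + (?N * ((1 + 1) + 2) + 2))
       (Inv (Suc k)) (update s' ''j'' 0 0 (Suc k))" if k: "k < ?N" "Inv k s'" for k s'
    proof (intro wp_seq wp_assign, rule wp_for[where Inv = "Inv2 k"])
      show "aval (Var ''jobs'') s' = ?N \<and> s' ''h'' 0 0 = k'" if "Inv2 k k' s'" for k' s'
        using that jobs by (simp add: Inv2_def)
      show "Inv (Suc k) s'" if "Inv2 k ?N s'" for s'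
      proof -
        have "{1..Suc k} = insert (Suc k) {1..k}" by auto
        then show ?thesis using that by (simp add: Inv_def Inv2_def ready_def jobs_def)
      qed
      show "wp (Cond (And (Equal (Cell ''prec'' (Var ''h'') (Var ''j'')) (Num 1))
          (Less (Elem ''done'' ''h'') (Elem ''len'' ''h'')))
         (Assign ''ok'' (Var ''j'') (Num 0) (Num 0)) Skip) (1 + 1) (Inv2 k (Suc k')) (update s' ''h'' 0 0 (Suc k'))"
        if k': "k' < ?N" "Inv2 k k' s'" for k' s'
      proof -
        let ?s = "update s' ''h'' 0 0 (Suc k')"
        have ag: "agree ?X s ?s" using k' by (simp add: Inv2_def agree_update)
        have "holds I ?s" using holds_agree[OF I ag] by simp
        moreover have "?s ''done'' = s ''done''" using agreeD[OF ag, of "''done''"] by simp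
        moreover have "Suc k \<in> jobs I" "Suc k' \<in> jobs I" using k k' by (auto simp: jobs_def)
        ultimately have "bval (And (Equal (Cell ''prec'' (Var ''h'') (Var ''j'')) (Num 1))
          (Less (Elem ''done'' ''h'') (Elem ''len'' ''h''))) ?s \<longleftrightarrow> prec I (Suc k') (Suc k) \<and> dn s (Suc k') < len I (Suc k')"
          using k' by (simp add: holds_def Inv2_def dn_def)
        moreover have "{1..Suc k'} = insert (Suc k') {1..k'}" by auto
        ultimately show ?thesis
          using k' ag by (intro wp_cond wp_assign wp_skip) (auto simp: Inv2_def agree_update)
      qed
    qed (use k in \<open>auto simp: Inv_def Inv2_def agree_update\<close>)
    show "agree ?X s s' \<and> (\<forall>j\<in>jobs I. s' ''ok'' j 0 = 1 \<longleftrightarrow> ready I (dn s) j)" if "Inv ?N s'" for s'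
      using that by (simp add: Inv_def jobs_def)
  qed
  then show ?thesis by (rule wp_conseq) (simp_all add: algebra_simps)
qed

text \<open>The second search overrides the first: a machine continues its unfinished job before it starts
  a new one.\<close>

definition pick :: com where
  "pick = Seq (Set ''c'' (Num 0)) (Seq
     (select (And (And (Equal (Elem ''mach'' ''j'') (Num 0)) (Equal (Elem ''ok'' ''j'') (Num 1)))
       (Less (Elem ''done'' ''j'') (Elem ''len'' ''j''))))
     (select (And (Equal (Elem ''mach'' ''j'') (Var ''i'')) (Less (Elem ''done'' ''j'') (Elem ''len'' ''j'')))))"

lemma wp_pick:
  assumes I: "holds I s" and ok: "\<forall>j\<in>jobs I. s ''ok'' j 0 = 1 \<longleftrightarrow> R j"
  shows "wp pick (8 * num_jobs I + 5) (\<lambda>s'. agree {''c'', ''j''} s s' \<and>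
    (if s' ''c'' 0 0 = 0
     then \<forall>j\<in>jobs I. dn s j < len I j \<longrightarrow> mc s j \<noteq> s ''i'' 0 0 \<and> \<not> (mc s j = 0 \<and> R j)
     else s' ''c'' 0 0 \<in> jobs I \<and> dn s (s' ''c'' 0 0) < len I (s' ''c'' 0 0) \<and>
       (mc s (s' ''c'' 0 0) = s ''i'' 0 0 \<or> mc s (s' ''c'' 0 0) = 0 \<and> R (s' ''c'' 0 0) \<and>
         (\<forall>j\<in>jobs I. dn s j < len I j \<longrightarrow> mc s j \<noteq> s ''i'' 0 0)))) s"
    (is "wp _ _ ?Q s")
proof -
  let ?N = "num_jobs I" and ?X = "{''c'', ''j''}"
  let ?B1 = "\<lambda>j. mc s j = 0 \<and> R j \<and> dn s j < len I j"
  let ?B2 = "\<lambda>j. mc s j = s ''i'' 0 0 \<and> dn s j < len I j"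
  let ?b1 = "And (And (Equal (Elem ''mach'' ''j'') (Num 0)) (Equal (Elem ''ok'' ''j'') (Num 1)))
       (Less (Elem ''done'' ''j'') (Elem ''len'' ''j''))"
  let ?b2 = "And (Equal (Elem ''mach'' ''j'') (Var ''i'')) (Less (Elem ''done'' ''j'') (Elem ''len'' ''j''))"
  have frame: "s' ''mach'' = s ''mach''" "s' ''ok'' = s ''ok''" "s' ''done'' = s ''done''"
      "s' ''len'' = s ''len''" "s' ''i'' = s ''i''" "s' ''jobs'' 0 0 = ?N" if "agree ?X s s'" for s'
    using agreeD[OF that] I by (simp_all add: holds_def)
  have len: "s ''len'' j 0 = len I j" if "j \<in> {1..?N}" for j
    using I that by (simp add: holds_def jobs_def)
  have B: "bval ?b1 s' \<longleftrightarrow> ?B1 (s' ''j'' 0 0)" "bval ?b2 s' \<longleftrightarrow> ?B2 (s' ''j'' 0 0)"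
    if "agree ?X s s'" "s' ''j'' 0 0 \<in> {1..?N}" for s'
    using frame[OF that(1)] len[OF that(2)] ok[unfolded jobs_def, rule_format, OF that(2)]
    by (simp_all add: dn_def mc_def)
  let ?s = "update s ''c'' 0 0 0"
  have ag: "agree ?X s ?s" by (simp add: agree_update agree_refl)
  have "wp (select ?b1) (4 * ?N + 2) (\<lambda>s'. agree ?X s s' \<and>
      (if \<exists>j\<in>{1..?N}. ?B1 j then s' ''c'' 0 0 \<in> {1..?N} \<and> ?B1 (s' ''c'' 0 0) else s' ''c'' 0 0 = 0)) ?s"
  proof (rule wp_conseq[OF wp_select[where B = ?B1 and N = ?N]])
    show "?s ''jobs'' 0 0 = ?N" using frame(6)[OF ag] .
    show "bval ?b1 s' = ?B1 (s' ''j'' 0 0)" if "agree ?X ?s s'" "s' ''j'' 0 0 \<in> {1..?N}" for s'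
      using B(1) agree_trans[OF ag that(1)] that(2) by simp
    show "agree ?X s s' \<and> (if \<exists>j\<in>{1..?N}. ?B1 j
        then s' ''c'' 0 0 \<in> {1..?N} \<and> ?B1 (s' ''c'' 0 0) else s' ''c'' 0 0 = 0)"
      if "agree ?X ?s s' \<and> (if \<exists>j\<in>{1..?N}. ?B1 j
        then s' ''c'' 0 0 \<in> {1..?N} \<and> ?B1 (s' ''c'' 0 0) else s' ''c'' 0 0 = ?s ''c'' 0 0)" for s'
      using agree_trans[OF ag, of s'] that by (auto split: if_splits)
  qed simp
  then have "wp (select ?b1) (4 * ?N + 2) (wp (select ?b2) (4 * ?N + 2) ?Q) ?s"
  proof (rule wp_conseq)
    fix s1 assume s1: "agree ?X s s1 \<and>
      (if \<exists>j\<in>{1..?N}. ?B1 j then s1 ''c'' 0 0 \<in> {1..?N} \<and> ?B1 (s1 ''c'' 0 0) else s1 ''c'' 0 0 = 0)"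
    have b2: "bval ?b2 s' = ?B2 (s' ''j'' 0 0)" if "agree ?X s1 s'" "s' ''j'' 0 0 \<in> {1..?N}" for s'
      using B(2) agree_trans[of ?X s s1 s'] s1 that by simp
    show "wp (select ?b2) (4 * ?N + 2) ?Q s1"
    proof (rule wp_conseq[OF wp_select[where B = ?B2 and N = ?N]])
      fix s' assume s': "agree ?X s1 s' \<and> (if \<exists>j\<in>{1..?N}. ?B2 j
        then s' ''c'' 0 0 \<in> {1..?N} \<and> ?B2 (s' ''c'' 0 0) else s' ''c'' 0 0 = s1 ''c'' 0 0)"
      have "agree ?X s s'"
        using agree_trans[of ?X s s1 s'] s1 s' by simp
      \<comment> \<open>Jobs start at 1, so the initial value 0 of \<open>c\<close> signals that
        both searches failed.\<close>
      moreover have "\<not> 0 \<in> {1..?N}" by simp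
      ultimately show "?Q s'"
        using s1 s' unfolding jobs_def by (auto split: if_splits)
    qed (use s1 frame(6)[of s1] b2 in simp_all)
  qed simp
  then have "wp pick (1 + ((4 * ?N + 2) + (4 * ?N + 2))) ?Q s"
    unfolding pick_def by (intro wp_seq wp_assign) (simp_all del: One_nat_def)
  then show ?thesis by (rule wp_conseq) auto
qed

section \<open>One step of the program\<close>

text \<open>The counter is raised first, so that \<open>done\<close> is already the number of the
  new task when its slot is written.\<close>

definition advance :: com where
  "advance = Seq (Assign ''done'' (Var ''c'') (Num 0) (Plus (Elem ''done'' ''c'') (Num 1)))
     (Assign ''slot'' (Elem ''done'' ''c'') (Var ''c'') (Var ''t''))"

lemma wp_advance:
  assumes "\<And>s'. agree {''done'', ''slot''} s s' \<Longrightarrow>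
    dn s' = (dn s)(s ''c'' 0 0 := Suc (dn s (s ''c'' 0 0))) \<Longrightarrow>
    s' ''slot'' = (s ''slot'')(Suc (dn s (s ''c'' 0 0)) :=
      (s ''slot'' (Suc (dn s (s ''c'' 0 0))))(s ''c'' 0 0 := s ''t'' 0 0)) \<Longrightarrow> Q s'"
  shows "wp advance (1 + 1) Q s"
  unfolding advance_def
  by (intro wp_seq wp_assign assms) (auto simp: agree_def update_def dn_def fun_eq_iff)


text \<open>For a continued job the assignment to \<open>mach\<close> rewrites the same value, so
  that continuing and starting share one branch.\<close>

definition run_machine :: com where
  "run_machine = Cond (Equal (Cell ''cap'' (Var ''i'') (Var ''t'')) (Num 1))
     (Seq pick (Cond (Equal (Var ''c'') (Num 0)) (Set ''idle'' (Num 1))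
       (Seq (Assign ''mach'' (Var ''c'') (Num 0) (Var ''i'')) advance))) Skip"

lemma wp_run_machine:
  assumes I: "holds I s" and ok: "\<forall>j\<in>jobs I. s ''ok'' j 0 = 1 \<longleftrightarrow> ready I D0 j"
    and inv: "machine_inv I K t D0 i (s ''idle'' 0 0 = 1) (dn s) (mc s) (s ''slot'')"
    and i: "s ''i'' 0 0 = Suc i" and t: "s ''t'' 0 0 = t" and irr: "irreflp_on (jobs I) (prec I)"
  shows "wp run_machine (8 * num_jobs I + 10) (\<lambda>s'.
    agree {''c'', ''j'', ''idle'', ''mach'', ''done'', ''slot''} s s' \<and>
    machine_inv I K t D0 (Suc i) (s' ''idle'' 0 0 = 1) (dn s') (mc s') (s' ''slot'')) s"
    (is "wp _ _ ?Q s")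
proof -
  let ?X = "{''c'', ''j'', ''idle'', ''mach'', ''done'', ''slot''}" and ?N = "num_jobs I"
  have "wp run_machine (((8 * ?N + 5) + ((1 + (1 + 1)) + 1)) + 1) ?Q s"
    unfolding run_machine_def
  proof (rule wp_cond)
    assume "\<not> bval (Equal (Cell ''cap'' (Var ''i'') (Var ''t'')) (Num 1)) s"
    then have "(Suc i, t) \<notin> available I" using I i t by (simp add: holds_def)
    then have "?Q s" using machine_inv_unavailable[OF inv] by (simp add: agree_refl)
    then show "wp Skip (8 * ?N + 5 + (1 + (1 + 1) + 1)) ?Q s"
      by (intro wp_skip) simp_all
  next
    assume "bval (Equal (Cell ''cap'' (Var ''i'') (Var ''t'')) (Num 1)) s"
    then have av: "(Suc i, t) \<in> available I" using I i t by (simp add: holds_def)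
    show "wp (Seq pick (Cond (Equal (Var ''c'') (Num 0)) (Set ''idle'' (Num 1))
       (Seq (Assign ''mach'' (Var ''c'') (Num 0) (Var ''i'')) advance))) (8 * ?N + 5 + (1 + (1 + 1) + 1)) ?Q s"
    proof (rule wp_seq, rule wp_conseq[OF wp_pick[OF I ok]], simp, rule wp_cond)
      fix s1 assume s1: "agree {''c'', ''j''} s s1 \<and>
        (if s1 ''c'' 0 0 = 0
         then \<forall>j\<in>jobs I. dn s j < len I j \<longrightarrow> mc s j \<noteq> s ''i'' 0 0 \<and> \<not> (mc s j = 0 \<and> ready I D0 j)
         else s1 ''c'' 0 0 \<in> jobs I \<and> dn s (s1 ''c'' 0 0) < len I (s1 ''c'' 0 0) \<and>
           (mc s (s1 ''c'' 0 0) = s ''i'' 0 0 \<or> mc s (s1 ''c'' 0 0) = 0 \<and> ready I D0 (s1 ''c'' 0 0) \<and>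
             (\<forall>j\<in>jobs I. dn s j < len I j \<longrightarrow> mc s j \<noteq> s ''i'' 0 0)))"
      have frame: "s1 ''mach'' = s ''mach''" "s1 ''done'' = s ''done''" "s1 ''slot'' = s ''slot''"
          "s1 ''i'' = s ''i''" "s1 ''t'' = s ''t''" "s1 ''idle'' = s ''idle''"
        using s1 agreeD[of "{''c'', ''j''}" s s1] by simp_all
      then have eq: "dn s1 = dn s" "mc s1 = mc s" by (simp_all add: dn_def mc_def fun_eq_iff)
      have ag: "agree ?X s s1" by (rule agree_mono[OF conjunct1[OF s1]]) simp
      {
        assume "bval (Equal (Var ''c'') (Num 0)) s1"
        then have none: "\<And>j. j \<in> jobs I \<Longrightarrow> dn s j < len I j \<Longrightarrow>
            mc s j \<noteq> Suc i \<and> \<not> (mc s j = 0 \<and> ready I D0 j)"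
          using s1 i by simp
        let ?s = "update s1 ''idle'' 0 0 1"
        have "dn ?s = dn s" "mc ?s = mc s" "?s ''slot'' = s ''slot''"
          using frame by (simp_all add: dn_def mc_def fun_eq_iff)
        then have "?Q ?s"
          using machine_inv_idle[OF inv none] ag by (simp add: agree_update)
        then show "wp (Set ''idle'' (Num 1)) (1 + (1 + 1)) ?Q s1"
          by (intro wp_assign) simp_all
      next
        assume "\<not> bval (Equal (Var ''c'') (Num 0)) s1"
        then have c: "s1 ''c'' 0 0 \<in> jobs I" "dn s (s1 ''c'' 0 0) < len I (s1 ''c'' 0 0)"
          "mc s (s1 ''c'' 0 0) = Suc i \<or> mc s (s1 ''c'' 0 0) = 0 \<and> ready I D0 (s1 ''c'' 0 0) \<and>
             (\<forall>j\<in>jobs I. dn s j < len I j \<longrightarrow> mc s j \<noteq> Suc i)"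
          using s1 i by simp_all
        let ?c = "s1 ''c'' 0 0"
        let ?s = "update s1 ''mach'' ?c 0 (Suc i)"
        have s: "dn ?s = dn s" "mc ?s = (mc s)(?c := Suc i)" "?s ''slot'' = s ''slot''" "?s ''t'' = s ''t''"
            "?s ''idle'' = s ''idle''" "?s ''c'' = s1 ''c''"
          using frame by (simp_all add: dn_def mc_def fun_eq_iff)
        have ag': "agree ?X s ?s" using ag by (simp add: agree_update)
        have "wp advance (1 + 1) ?Q ?s"
        proof (rule wp_advance, unfold s)
          fix s' assume s': "agree {''done'', ''slot''} ?s s'"
            "dn s' = (dn s)(?c := Suc (dn s ?c))"
            "s' ''slot'' = (s ''slot'')(Suc (dn s ?c) := (s ''slot'' (Suc (dn s ?c)))(?c := s ''t'' 0 0))"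
          have "agree ?X ?s s'" using s'(1) by (rule agree_mono) simp
          moreover have "s' ''mach'' = ?s ''mach''" "s' ''idle'' = s ''idle''"
            using agreeD[OF s'(1)] s(5) by simp_all
          moreover from this(1) have "mc s' = (mc s)(?c := Suc i)"
            using s(2) by (simp add: mc_def fun_eq_iff)
          ultimately show "?Q s'"
            using machine_inv_run[OF inv irr av c] s'(2,3) t agree_trans[OF ag', of s'] by simp
        qed
        then show "wp (Seq (Assign ''mach'' (Var ''c'') (Num 0) (Var ''i'')) advance) (1 + (1 + 1)) ?Q s1"
          using frame i by (intro wp_seq wp_assign) simp_all
      }
    qed
  qed
  then show ?thesis by (rule wp_conseq) simp
qed

definition catchup :: com where
  "catchup = For ''j'' (Var ''jobs'')
     (Cond (And (And (Less (Elem ''done'' ''j'') (Elem ''len'' ''j'')) (Neg (Equal (Elem ''mach'' ''j'') (Num 0))))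
         (Neg (Equal (Cell ''cap'' (Elem ''mach'' ''j'') (Var ''t'')) (Num 1))))
       (Seq (Set ''c'' (Var ''j'')) advance) Skip)"

lemma wp_catchup:
  assumes I: "holds I s" and t: "s ''t'' 0 0 = t" "0 < t" and irr: "irreflp_on (jobs I) (prec I)"
    and inv: "catchup_inv I K t D0 0 (dn s) (mc s) (s ''slot'')"
  shows "wp catchup (6 * num_jobs I + 2) (\<lambda>s'. agree {''c'', ''j'', ''done'', ''slot''} s s' \<and>
    catchup_inv I K t D0 (num_jobs I) (dn s') (mc s') (s' ''slot'')) s"
    (is "wp _ _ ?Q s")
proof -
  let ?X = "{''c'', ''j'', ''done'', ''slot''}" and ?N = "num_jobs I"
  let ?b = "And (And (Less (Elem ''done'' ''j'') (Elem ''len'' ''j'')) (Neg (Equal (Elem ''mach'' ''j'') (Num 0))))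
         (Neg (Equal (Cell ''cap'' (Elem ''mach'' ''j'') (Var ''t'')) (Num 1)))"
  define Inv where "Inv k s' \<longleftrightarrow> s' ''j'' 0 0 = k \<and> agree ?X s s' \<and>
    catchup_inv I K t D0 k (dn s') (mc s') (s' ''slot'')" for k s'
  have "wp catchup (?N * (((1 + (1 + 1)) + 1) + 2) + 2) ?Q s"
    unfolding catchup_def
  proof (rule wp_for[where Inv = Inv])
    have "dn (update s ''j'' 0 0 0) = dn s" "mc (update s ''j'' 0 0 0) = mc s"
      by (simp_all add: dn_def mc_def fun_eq_iff)
    then show "Inv 0 (update s ''j'' 0 0 0)"
      using inv by (simp add: Inv_def agree_refl agree_update)
    show "aval (Var ''jobs'') s' = ?N \<and> s' ''j'' 0 0 = k" if "Inv k s'" for k s'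
      using that I agreeD[of ?X s s' "''jobs''"] by (simp add: Inv_def holds_def)
    show "wp (Cond ?b (Seq (Set ''c'' (Var ''j'')) advance) Skip) ((1 + (1 + 1)) + 1) (Inv (Suc k))
        (update s' ''j'' 0 0 (Suc k))" if k: "k < ?N" "Inv k s'" for k s'
    proof -
      let ?s = "update s' ''j'' 0 0 (Suc k)"
      have ag: "agree ?X s ?s" using k by (simp add: Inv_def agree_update)
      have j: "Suc k \<in> jobs I" using k by (simp add: jobs_def)
      have tt: "?s ''t'' 0 0 = t" using t agreeD[OF ag, of "''t''"] by simp
      have eq: "dn ?s = dn s'" "mc ?s = mc s'" "?s ''slot'' = s' ''slot''"
        by (simp_all add: dn_def mc_def fun_eq_iff)
      have inv: "catchup_inv I K t D0 k (dn ?s) (mc ?s) (?s ''slot'')"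
        using k unfolding eq by (simp add: Inv_def)
      have "holds I ?s" using holds_agree[OF I ag] by simp
      then have b: "bval ?b ?s \<longleftrightarrow> dn ?s (Suc k) < len I (Suc k) \<and> mc ?s (Suc k) \<noteq> 0 \<and>
          (mc ?s (Suc k), t) \<notin> available I"
        using j tt by (simp add: holds_def dn_def mc_def)
      show ?thesis
      proof (rule wp_cond)
        assume "\<not> bval ?b ?s"
        then have "catchup_inv I K t D0 (Suc k) (dn ?s) (mc ?s) (?s ''slot'')"
          unfolding b by (rule catchup_inv_skip[OF inv])
        then have "Inv (Suc k) ?s"
          using ag by (simp add: Inv_def)
        then show "wp Skip (1 + (1 + 1)) (Inv (Suc k)) ?s"
          by (intro wp_skip) simp_all
      next
        assume "bval ?b ?s"
        then have c: "dn ?s (Suc k) < len I (Suc k)" "mc ?s (Suc k) \<noteq> 0"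
            "(mc ?s (Suc k), t) \<notin> available I"
          using b by blast+
        let ?u = "update ?s ''c'' 0 0 (Suc k)"
        have u: "dn ?u = dn ?s" "mc ?u = mc ?s" "?u ''slot'' = ?s ''slot''" "?u ''t'' 0 0 = t"
            "?u ''c'' 0 0 = Suc k" "?u ''j'' 0 0 = Suc k"
          using tt by (simp_all add: dn_def mc_def fun_eq_iff)
        have agu: "agree ?X s ?u" using ag by (simp add: agree_update)
        have "wp advance (1 + 1) (Inv (Suc k)) ?u"
        proof (rule wp_advance, unfold u)
          fix s2 assume s2: "agree {''done'', ''slot''} ?u s2"
            "dn s2 = (dn ?s)(Suc k := Suc (dn ?s (Suc k)))"
            "s2 ''slot'' = (?s ''slot'')(Suc (dn ?s (Suc k)) := (?s ''slot'' (Suc (dn ?s (Suc k))))(Suc k := t))"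
          have "agree ?X ?u s2" using s2(1) by (rule agree_mono) simp
          then have "agree ?X s s2" by (rule agree_trans[OF agu])
          moreover have "s2 ''mach'' = ?u ''mach''" "s2 ''j'' = ?u ''j''"
            using agreeD[OF s2(1)] by simp_all
          moreover from this(1) have "mc s2 = mc ?s"
            using u(2) by (simp add: mc_def fun_eq_iff)
          ultimately show "Inv (Suc k) s2"
            using catchup_inv_advance[OF inv irr refl j c t(2)] s2(2,3) u(6) unfolding Inv_def by simp
        qed
        then show "wp (Seq (Set ''c'' (Var ''j'')) advance) (1 + (1 + 1)) (Inv (Suc k)) ?s"
          by (intro wp_seq wp_assign) simp_all
      qed
    qed
  qed (simp add: Inv_def)
  then show ?thesis by (rule wp_conseq) simp
qed

definition step :: com where
  "step = Seq find_ready (Seq (Set ''idle'' (Num 0)) (Seq (For ''i'' (Var ''machines'') run_machine)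
     (Cond (Equal (Var ''idle'') (Num 1)) catchup Skip)))"

text \<open>Left unsimplified so that the summands match those produced by composing the rules for
  sequences, conditionals and loops.\<close>

definition step_time :: "nat \<Rightarrow> nat \<Rightarrow> nat" where
  "step_time n m = (n * (4 * n + 5) + 2) + (1 + ((m * ((8 * n + 10) + 2) + 2) + ((6 * n + 2) + 1)))"

lemma wp_step:
  assumes I: "holds I s" and t: "s ''t'' 0 0 = t" "0 < t"
    and irr: "irreflp_on (jobs I) (prec I)" and tr: "transp_on (jobs I) (prec I)"
    and inv: "sched_inv I t (dn s) (mc s) (s ''slot'')"
  shows "wp step (step_time (num_jobs I) (num_machines I)) (\<lambda>s'.
    agree {''ok'', ''h'', ''i'', ''c'', ''j'', ''idle'', ''mach'', ''done'', ''slot''} s s' \<and>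
    sched_inv I (Suc t) (dn s') (mc s') (s' ''slot'')) s"
    (is "wp _ _ ?Q s")
proof -
  let ?X = "{''ok'', ''h'', ''i'', ''c'', ''j'', ''idle'', ''mach'', ''done'', ''slot''}"
  let ?N = "num_jobs I" and ?M = "num_machines I"
  obtain K where K: "core I K t (dn s) (dn s) (mc s) (s ''slot'')" "short I K (dn s)"
      "unfinished I (dn s) \<longrightarrow> filled I K t (dn s) (mc s) (s ''slot'')"
    using inv unfolding sched_inv_def by blast
  \<comment> \<open>The counters \<open>dn s\<close> from the beginning of the step play the role of
    \<open>D0\<close>.\<close>
  define Inv where "Inv k s' \<longleftrightarrow> s' ''i'' 0 0 = k \<and> agree ?X s s' \<and>
    (\<forall>j\<in>jobs I. s' ''ok'' j 0 = 1 \<longleftrightarrow> ready I (dn s) j) \<and>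
    machine_inv I K t (dn s) k (s' ''idle'' 0 0 = 1) (dn s') (mc s') (s' ''slot'')" for k s'
  have last: "wp (Cond (Equal (Var ''idle'') (Num 1)) catchup Skip) ((6 * ?N + 2) + 1) ?Q s'"
    if "Inv ?M s'" for s'
  proof (rule wp_cond)
    have ag: "agree ?X s s'" using that by (simp add: Inv_def)
    {
      assume "bval (Equal (Var ''idle'') (Num 1)) s'"
      then have "catchup_inv I K t (dn s) 0 (dn s') (mc s') (s' ''slot'')"
        using that by (intro catchup_inv_init) (simp add: Inv_def)
      moreover have "holds I s'" using holds_agree[OF I ag] by simp
      moreover have "s' ''t'' 0 0 = t" using agreeD[OF ag, of "''t''"] t by simp
      ultimately show "wp catchup (6 * ?N + 2) ?Q s'"
      proof (intro wp_conseq[OF wp_catchup[OF _ _ t(2) irr]])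
        fix s2 assume s2: "agree {''c'', ''j'', ''done'', ''slot''} s' s2 \<and>
          catchup_inv I K t (dn s) ?N (dn s2) (mc s2) (s2 ''slot'')"
        have "agree ?X s' s2" by (rule agree_mono[OF conjunct1[OF s2]]) simp
        then show "?Q s2"
          using agree_trans[OF ag] sched_inv_catchup[OF conjunct2[OF s2] K(2) irr tr] by blast
      qed simp_all
    next
      assume "\<not> bval (Equal (Var ''idle'') (Num 1)) s'"
      then have "sched_inv I (Suc t) (dn s') (mc s') (s' ''slot'')"
        using that K(2) by (intro sched_inv_busy) (simp_all add: Inv_def)
      then show "wp Skip (6 * ?N + 2) ?Q s'"
        using ag by (intro wp_skip) simp_all
    }
  qed
  have loop: "wp (For ''i'' (Var ''machines'') run_machine) (?M * ((8 * ?N + 10) + 2) + 2)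
      (wp (Cond (Equal (Var ''idle'') (Num 1)) catchup Skip) ((6 * ?N + 2) + 1) ?Q) s1"
    if s1: "agree ?X s s1" "\<forall>j\<in>jobs I. s1 ''ok'' j 0 = 1 \<longleftrightarrow> ready I (dn s) j"
      "s1 ''idle'' 0 0 = 0" "s1 ''slot'' = s ''slot''" "dn s1 = dn s" "mc s1 = mc s" for s1
  proof (rule wp_for[where Inv = Inv])
    have "dn (update s1 ''i'' 0 0 0) = dn s" "mc (update s1 ''i'' 0 0 0) = mc s"
      using s1(5,6) by (simp_all add: dn_def mc_def fun_eq_iff)
    then show "Inv 0 (update s1 ''i'' 0 0 0)"
      using s1 machine_inv_init[OF K(1,3)] by (simp add: Inv_def agree_update)
    show "aval (Var ''machines'') s' = ?M \<and> s' ''i'' 0 0 = k" if "Inv k s'" for k s'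
      using that I agreeD[of ?X s s' "''machines''"] by (simp add: Inv_def holds_def)
    show "wp run_machine (8 * ?N + 10) (Inv (Suc k)) (update s' ''i'' 0 0 (Suc k))"
      if k: "k < ?M" "Inv k s'" for k s'
    proof -
      let ?s = "update s' ''i'' 0 0 (Suc k)"
      have ag: "agree ?X s ?s" using k by (simp add: Inv_def agree_update)
      have I': "holds I ?s" using holds_agree[OF I ag] by simp
      have t': "?s ''t'' 0 0 = t" using agreeD[OF ag, of "''t''"] t by simp
      have i': "?s ''i'' 0 0 = Suc k" by simp
      have ok: "\<forall>j\<in>jobs I. ?s ''ok'' j 0 = 1 \<longleftrightarrow> ready I (dn s) j"
        using k by (simp add: Inv_def)
      have "dn ?s = dn s'" "mc ?s = mc s'" by (simp_all add: dn_def mc_def fun_eq_iff)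
      then have inv': "machine_inv I K t (dn s) k (?s ''idle'' 0 0 = 1) (dn ?s) (mc ?s) (?s ''slot'')"
        using k by (simp add: Inv_def)
      show ?thesis
      proof (rule wp_conseq[OF wp_run_machine[OF I' ok inv' i' t' irr]])
        fix s2 assume s2: "agree {''c'', ''j'', ''idle'', ''mach'', ''done'', ''slot''} ?s s2 \<and>
          machine_inv I K t (dn s) (Suc k) (s2 ''idle'' 0 0 = 1) (dn s2) (mc s2) (s2 ''slot'')"
        have "agree ?X ?s s2" by (rule agree_mono[OF conjunct1[OF s2]]) simp
        then have "agree ?X s s2" by (rule agree_trans[OF ag])
        moreover have "s2 ''ok'' = ?s ''ok''" "s2 ''i'' = ?s ''i''"
          using agreeD[OF conjunct1[OF s2]] by simp_all
        ultimately show "Inv (Suc k) s2"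
          using s2 ok i' unfolding Inv_def by simp
      qed simp
    qed
  qed (fact last)
  show ?thesis
    unfolding step_def step_time_def
  proof (intro wp_seq wp_conseq[OF wp_find_ready[OF I]] wp_assign)
    fix s1 assume s1: "agree {''ok'', ''j'', ''h''} s s1 \<and>
      (\<forall>j\<in>jobs I. s1 ''ok'' j 0 = 1 \<longleftrightarrow> ready I (dn s) j)"
    let ?s = "update s1 ''idle'' 0 0 0"
    have "agree ?X s s1" by (rule agree_mono[OF conjunct1[OF s1]]) simp
    then have "agree ?X s ?s" by (simp add: agree_update)
    moreover have "s1 ''slot'' = s ''slot''" "s1 ''done'' = s ''done''" "s1 ''mach'' = s ''mach''"
      using agreeD[OF conjunct1[OF s1]] by simp_all
    ultimately show "wp (For ''i'' (Var ''machines'') run_machine) (?M * ((8 * ?N + 10) + 2) + 2)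
      (wp (Cond (Equal (Var ''idle'') (Num 1)) catchup Skip) ((6 * ?N + 2) + 1) ?Q)
      (update s1 ''idle'' (aval (Num 0) s1) (aval (Num 0) s1) (aval (Num 0) s1))"
      using s1 by (intro loop) (simp_all add: dn_def mc_def fun_eq_iff)
  qed simp_all
qed

section \<open>Output and the complete program\<close>

definition finish :: com where
  "finish = For ''j'' (Var ''jobs'') (For ''k'' (Elem ''len'' ''j'')
     (Seq (Assign ''machine'' (Var ''k'') (Var ''j'') (Elem ''mach'' ''j''))
       (Cond (Equal (Cell ''cap'' (Elem ''mach'' ''j'') (Cell ''slot'' (Var ''k'') (Var ''j''))) (Num 1))
         (Assign ''discarded'' (Var ''k'') (Var ''j'') (Num 0))
         (Assign ''discarded'' (Var ''k'') (Var ''j'') (Num 1)))))"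

lemma wp_finish:
  assumes I: "holds I s" and L: "\<And>j. j \<in> jobs I \<Longrightarrow> len I j \<le> L"
  shows "wp finish (num_jobs I * (5 * L + 4) + 2) (\<lambda>s'. s' ''slot'' = s ''slot'' \<and>
    (\<forall>j\<in>jobs I. \<forall>k\<in>{1..len I j}. s' ''machine'' k j = mc s j \<and>
      (s' ''discarded'' k j = 0 \<longleftrightarrow> (mc s j, s ''slot'' k j) \<in> available I))) s"
    (is "wp _ _ ?Q s")
proof -
  let ?X = "{''j'', ''k'', ''machine'', ''discarded''}" and ?N = "num_jobs I"
  let ?b = "Equal (Cell ''cap'' (Elem ''mach'' ''j'') (Cell ''slot'' (Var ''k'') (Var ''j''))) (Num 1)"
  let ?d = "Cond ?b (Assign ''discarded'' (Var ''k'') (Var ''j'') (Num 0))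
         (Assign ''discarded'' (Var ''k'') (Var ''j'') (Num 1))"
  let ?c = "Seq (Assign ''machine'' (Var ''k'') (Var ''j'') (Elem ''mach'' ''j'')) ?d"
  define good where "good s' k j \<longleftrightarrow> s' ''machine'' k j = mc s j \<and>
      (s' ''discarded'' k j = 0 \<longleftrightarrow> (mc s j, s ''slot'' k j) \<in> available I)" for s' k j
  define Inv where "Inv j s' \<longleftrightarrow> s' ''j'' 0 0 = j \<and> agree ?X s s' \<and>
    (\<forall>j'\<in>{1..j}. \<forall>k\<in>{1..len I j'}. good s' k j')" for j s'
  define Inv2 where "Inv2 j k s' \<longleftrightarrow> s' ''k'' 0 0 = k \<and> s' ''j'' 0 0 = Suc j \<and> agree ?X s s' \<and>
    (\<forall>j'\<in>{1..j}. \<forall>k\<in>{1..len I j'}. good s' k j') \<and> (\<forall>k'\<in>{1..k}. good s' k' (Suc j))" for j k s'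
  have upd: "good (update s' ''j'' 0 0 v) k j \<longleftrightarrow> good s' k j"
    "good (update s' ''k'' 0 0 v) k j \<longleftrightarrow> good s' k j" for s' v k j
    by (simp_all add: good_def)
  have "wp finish (?N * ((5 * L + 2) + 2) + 2) ?Q s"
    unfolding finish_def
  proof (rule wp_for[where Inv = Inv])
    show "Inv 0 (update s ''j'' 0 0 0)"
      by (simp add: Inv_def agree_refl agree_update)
    show "aval (Var ''jobs'') s' = ?N \<and> s' ''j'' 0 0 = j" if "Inv j s'" for j s'
      using that I agreeD[of ?X s s' "''jobs''"] by (simp add: Inv_def holds_def)
    show "?Q s'" if "Inv ?N s'" for s'
      using that agreeD[of ?X s s' "''slot''"] by (simp add: Inv_def good_def jobs_def)
    show "wp (For ''k'' (Elem ''len'' ''j'') ?c) (5 * L + 2) (Inv (Suc j)) (update s' ''j'' 0 0 (Suc j))"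
      if j: "j < ?N" "Inv j s'" for j s'
    proof -
      have J: "Suc j \<in> jobs I" using j by (simp add: jobs_def)
      have "wp (For ''k'' (Elem ''len'' ''j'') ?c) (len I (Suc j) * ((1 + (1 + 1)) + 2) + 2)
        (Inv (Suc j)) (update s' ''j'' 0 0 (Suc j))"
      proof (rule wp_for[where Inv = "Inv2 j"])
        show "Inv2 j 0 (update (update s' ''j'' 0 0 (Suc j)) ''k'' 0 0 0)"
          using j by (simp add: Inv_def Inv2_def agree_update upd)
        show "aval (Elem ''len'' ''j'') s2 = len I (Suc j) \<and> s2 ''k'' 0 0 = k" if "Inv2 j k s2" for k s2
          using that I J agreeD[of ?X s s2 "''len''"] by (simp add: Inv2_def holds_def)
        show "Inv (Suc j) s2" if "Inv2 j (len I (Suc j)) s2" for s2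
        proof -
          have "{1..Suc j} = insert (Suc j) {1..j}" by auto
          then show ?thesis using that by (simp add: Inv_def Inv2_def)
        qed
        show "wp ?c (1 + (1 + 1)) (Inv2 j (Suc k)) (update s2 ''k'' 0 0 (Suc k))"
          if k: "k < len I (Suc j)" "Inv2 j k s2" for k s2
        proof -
          let ?s = "update (update s2 ''k'' 0 0 (Suc k)) ''machine'' (Suc k) (Suc j) (mc s (Suc j))"
          have ag2: "agree ?X s s2" using k by (simp add: Inv2_def)
          then have ag: "agree ?X s ?s" by (simp add: agree_update)
          have s2: "s2 ''j'' 0 0 = Suc j" "s2 ''mach'' = s ''mach''" "s2 ''slot'' = s ''slot''"
            using k agreeD[OF ag2] by (simp_all add: Inv2_def)
          have "holds I ?s" using holds_agree[OF I ag] by simp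
          then have b: "bval ?b ?s \<longleftrightarrow> (mc s (Suc j), s ''slot'' (Suc k) (Suc j)) \<in> available I"
            using s2 by (simp add: holds_def mc_def)
          have "Inv2 j (Suc k) (update ?s ''discarded'' (Suc k) (Suc j) v)"
            if "v = 0 \<longleftrightarrow> (mc s (Suc j), s ''slot'' (Suc k) (Suc j)) \<in> available I" for v
          proof -
            let ?u = "update ?s ''discarded'' (Suc k) (Suc j) v"
            have "good ?u k' j'" if "good s2 k' j'" for k' j'
              using that \<open>v = 0 \<longleftrightarrow> _\<close> by (cases "k' = Suc k \<and> j' = Suc j") (auto simp: good_def)
            moreover have "good ?u (Suc k) (Suc j)"
              using that by (simp add: good_def)
            moreover have "{1..Suc k} = insert (Suc k) {1..k}" by auto
            ultimately show ?thesis
              using k(2) ag s2(1) by (simp add: Inv2_def agree_update)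
          qed
          then have "wp ?d (1 + 1) (Inv2 j (Suc k)) ?s"
            using b s2(1) by (intro wp_cond wp_assign) simp_all
          then show ?thesis
            using s2 by (intro wp_seq wp_assign) (simp_all add: mc_def)
        qed
      qed
      then show ?thesis
        by (rule wp_conseq) (use L[OF J] in simp)
    qed
  qed
  then show ?thesis by (rule wp_conseq) (simp add: algebra_simps)
qed

definition scheduler :: com where
  "scheduler = Cond (Less (Num 0) (Var ''jobs'')) (Seq (For ''t'' (Var ''horizon'') step) finish) Skip"

definition scheduler_time :: "nat \<Rightarrow> nat \<Rightarrow> nat \<Rightarrow> nat \<Rightarrow> nat" where
  "scheduler_time n m T L = ((T * (step_time n m + 2) + 2) + (n * (5 * L + 4) + 2)) + 1"

lemma wp_scheduler:
  assumes I: "valid_inst I" and S: "window_assignment I S" and n: "0 < num_jobs I"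
    and L: "\<And>j. j \<in> jobs I \<Longrightarrow> len I j \<le> L"
  shows "wp scheduler (scheduler_time (num_jobs I) (num_machines I) (horizon I) L)
    (\<lambda>s. good_schedule I (discarded I s) (schedule s) \<and>
      card (discarded I s) \<le> num_machines I * max_chain I) (input I)"
    (is "wp _ _ ?Q _")
proof -
  let ?s = "input I"
  let ?X = "{''t'', ''ok'', ''h'', ''i'', ''c'', ''j'', ''idle'', ''mach'', ''done'', ''slot''}"
  have irr: "irreflp_on (jobs I) (prec I)" and tr: "transp_on (jobs I) (prec I)"
    using I by (simp_all add: valid_inst_def)
  define Inv where "Inv t s \<longleftrightarrow> s ''t'' 0 0 = t \<and> agree ?X ?s s \<and>
    sched_inv I (Suc t) (dn s) (mc s) (s ''slot'')" for t s
  have fin: "wp finish (num_jobs I * (5 * L + 4) + 2) ?Q s" if s: "Inv (horizon I) s" for s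
  proof (rule wp_conseq[OF wp_finish[OF _ L]])
    show "holds I s" using holds_agree[OF holds_input, of ?X I s] s by (simp add: Inv_def)
    fix s' assume s': "s' ''slot'' = s ''slot'' \<and> (\<forall>j\<in>jobs I. \<forall>k\<in>{1..len I j}.
      s' ''machine'' k j = mc s j \<and>
      (s' ''discarded'' k j = 0 \<longleftrightarrow> (mc s j, s ''slot'' k j) \<in> available I))"
    have T: "(k, j) \<in> tasks I \<longleftrightarrow> j \<in> jobs I \<and> k \<in> {1..len I j}" for k j
      by (auto simp: tasks_def job_tasks_def)
    have P: "schedule s' a = place (mc s) (s ''slot'') a" if "a \<in> tasks I" for a
      using that s' by (cases a) (simp add: T schedule_def place_def)
    have X: "discarded I s' = {a \<in> tasks I. place (mc s) (s ''slot'') a \<notin> available I}"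
    proof -
      have "s' ''discarded'' k j \<noteq> 0 \<longleftrightarrow> place (mc s) (s ''slot'') (k, j) \<notin> available I"
        if "(k, j) \<in> tasks I" for k j
        using that s' by (simp add: T place_def)
      then show ?thesis unfolding discarded_def by blast
    qed
    show "?Q s'"
      using sched_inv_final[OF _ S X P] s unfolding Inv_def by blast
  qed simp_all
  have "wp (For ''t'' (Var ''horizon'') step)
      (horizon I * (step_time (num_jobs I) (num_machines I) + 2) + 2)
      (wp finish (num_jobs I * (5 * L + 4) + 2) ?Q) ?s"
  proof (rule wp_for[where Inv = Inv])
    let ?u = "update ?s ''t'' 0 0 0"
    \<comment> \<open>These names are not input names, so the cells are 0, which is the abstract
      initial state.\<close>
    have "?s ''done'' = (\<lambda>_ _. 0)" "?s ''mach'' = (\<lambda>_ _. 0)" "?s ''slot'' = (\<lambda>_ _. 0)"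
      by (simp_all add: input_def fun_eq_iff)
    then have "dn ?u = (\<lambda>_. 0)" "mc ?u = (\<lambda>_. 0)" "?u ''slot'' = (\<lambda>_ _. 0)"
      by (simp_all add: dn_def mc_def fun_eq_iff)
    then show "Inv 0 ?u"
      using sched_inv_init by (simp add: Inv_def agree_refl agree_update)
    show "aval (Var ''horizon'') s = horizon I \<and> s ''t'' 0 0 = t" if "Inv t s" for t s
      using that holds_input[of I] agreeD[of ?X ?s s "''horizon''"] by (simp add: Inv_def holds_def)
    show "wp step (step_time (num_jobs I) (num_machines I)) (Inv (Suc t)) (update s ''t'' 0 0 (Suc t))"
      if t: "t < horizon I" "Inv t s" for t s
    proof -
      let ?u = "update s ''t'' 0 0 (Suc t)"
      have ag: "agree ?X ?s ?u" using t by (simp add: Inv_def agree_update)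
      have h: "holds I ?u" using holds_agree[OF holds_input ag] by simp
      have "dn ?u = dn s" "mc ?u = mc s" "?u ''slot'' = s ''slot''"
        by (simp_all add: dn_def mc_def fun_eq_iff)
      then have inv: "sched_inv I (Suc t) (dn ?u) (mc ?u) (?u ''slot'')"
        using t by (simp add: Inv_def)
      show ?thesis
      proof (rule wp_conseq[OF wp_step[OF h _ zero_less_Suc irr tr inv]])
        fix s2 assume s2: "agree {''ok'', ''h'', ''i'', ''c'', ''j'', ''idle'', ''mach'', ''done'', ''slot''} ?u s2 \<and>
          sched_inv I (Suc (Suc t)) (dn s2) (mc s2) (s2 ''slot'')"
        have "agree ?X ?u s2" by (rule agree_mono[OF conjunct1[OF s2]]) simp
        then have "agree ?X ?s s2" by (rule agree_trans[OF ag])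
        moreover have "s2 ''t'' = ?u ''t''"
          using agreeD[OF conjunct1[OF s2]] by simp
        ultimately show "Inv (Suc t) s2"
          using s2 unfolding Inv_def by simp
      qed simp_all
    qed
  qed (fact fin)
  moreover have "bval (Less (Num 0) (Var ''jobs'')) ?s"
    using n holds_input[of I] by (simp add: holds_def)
  ultimately show ?thesis
    unfolding scheduler_def scheduler_time_def by (intro wp_cond wp_seq) blast+
qed

section \<open>Polynomial bounds in the input size\<close>

text \<open>A job has a task, and S' places it; so m and T are positive and each is at most the
  product m T, which the table \<open>cap\<close> contributes to the input size. The tasks of one
  job occupy distinct available pairs, hence its length is at most m T too.\<close>

lemma size_bounds:
  assumes I: "valid_inst I" and S: "window_assignment I S" and n: "0 < num_jobs I"
  shows "num_intervals I \<noteq> 0" "num_jobs I \<le> input_size I" "num_machines I \<le> input_size I"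
    "horizon I \<le> input_size I" "\<And>j. j \<in> jobs I \<Longrightarrow> len I j \<le> input_size I"
proof -
  have one: "1 \<in> jobs I" using n by (simp add: jobs_def)
  then have len1: "0 < len I 1" and "\<exists>q\<in>{1..num_intervals I}. release I 1 = Min (interval I q)"
    using I unfolding valid_inst_def by blast+
  then show "num_intervals I \<noteq> 0" by auto
  have mT: "num_machines I * horizon I \<le> input_size I"
    and nn: "num_jobs I * num_jobs I \<le> input_size I"
    by (simp_all add: input_size_def)
  have "(1, 1) \<in> tasks I" using one len1 by (auto simp: tasks_def job_tasks_def)
  then have "S (1, 1) \<in> available I" using S by (auto simp: window_assignment_def)
  then have pos: "0 < num_machines I" "0 < horizon I"
    by (auto simp: available_def machines_def slots_def)
  show "num_jobs I \<le> input_size I" using nn n by (metis le_trans le_square)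
  show "num_machines I \<le> input_size I" "horizon I \<le> input_size I"
    using mT pos by (simp_all add: le_trans[rotated])
  have av: "available I \<subseteq> machines I \<times> slots I" by (auto simp: available_def)
  have fin: "finite (machines I \<times> slots I)" by (simp add: machines_def slots_def)
  show "len I j \<le> input_size I" if "j \<in> jobs I" for j
  proof -
    have sub: "job_tasks I j \<subseteq> tasks I" using that by (auto simp: tasks_def)
    have "len I j = card (job_tasks I j)" by (simp add: job_tasks_def card_cartesian_product)
    also have "\<dots> \<le> card (machines I \<times> slots I)"
      using S sub av by (intro card_inj_on_le[OF inj_on_subset[OF _ sub] _ fin])
        (auto simp: window_assignment_def)
    also have "\<dots> = num_machines I * horizon I"
      by (simp add: card_cartesian_product machines_def slots_def)
    finally show ?thesis using mT by simp
  qed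
qed

lemma step_time_mono: "n \<le> n' \<Longrightarrow> m \<le> m' \<Longrightarrow> step_time n m \<le> step_time n' m'"
  unfolding step_time_def by (intro add_mono mult_mono order_refl) simp_all

lemma scheduler_time_mono:
  "n \<le> n' \<Longrightarrow> m \<le> m' \<Longrightarrow> T \<le> T' \<Longrightarrow> L \<le> L' \<Longrightarrow> scheduler_time n m T L \<le> scheduler_time n' m' T' L'"
  unfolding scheduler_time_def by (intro add_mono mult_mono step_time_mono order_refl) simp_all

lemma scheduler_time_poly: "\<exists>P :: nat poly. \<forall>x. poly P x = scheduler_time x x x x"
proof -
  define X :: "nat poly" where "X = [:0, 1:]"
  define S where "S = (X * ([:4:] * X + [:5:]) + [:2:]) + ([:1:] + ((X * (([:8:] * X + [:10:]) + [:2:]) + [:2:]) +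
    (([:6:] * X + [:2:]) + [:1:])))"
  have X: "poly X x = x" for x by (simp add: X_def)
  have "poly S x = step_time x x" for x
    by (simp add: S_def step_time_def X)
  then have "poly (((X * (S + [:2:]) + [:2:]) + (X * ([:5:] * X + [:4:]) + [:2:])) + [:1:]) x =
      scheduler_time x x x x" for x
    by (simp add: scheduler_time_def X)
  then show ?thesis by blast
qed

text \<open>Without jobs, \<open>num_machines I\<close> and \<open>horizon I\<close> need not be polynomial in \<open>input_size I\<close> (their
  product may be 0), so the program must not loop over them.\<close>

lemma exec_scheduler_no_jobs:
  assumes "num_jobs I = 0"
  shows "exec scheduler (input I) 2 (input I)"
proof -
  have "\<not> bval (Less (Num 0) (Var ''jobs'')) (input I)"
    using assms holds_input[of I] by (simp add: holds_def)
  from exec.CondFalse[OF this exec.Skip] show ?thesis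
    unfolding scheduler_def one_add_one .
qed

theorem theorem3:
  shows "\<exists>(c :: com) (P :: nat poly). \<forall>I :: inst.
    valid_inst I \<longrightarrow> (\<exists>S'. window_assignment I S') \<longrightarrow>
    (\<exists>n s. exec c (input I) n s \<and> n \<le> poly P (input_size I) \<and>
       good_schedule I (discarded I s) (schedule s) \<and>
       card (discarded I s) \<le> 2 * (num_intervals I)\<^sup>2 * num_machines I * max_chain I)"
proof -
  obtain P :: "nat poly" where P: "\<And>x. poly P x = scheduler_time x x x x"
    using scheduler_time_poly by blast
  have "\<exists>n s. exec scheduler (input I) n s \<and> n \<le> poly P (input_size I) \<and>
       good_schedule I (discarded I s) (schedule s) \<and>
       card (discarded I s) \<le> 2 * (num_intervals I)\<^sup>2 * num_machines I * max_chain I"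
    if I: "valid_inst I" and S: "window_assignment I S" for I S
  proof (cases "num_jobs I = 0")
    case True
    then have "tasks I = {}" "jobs I = {}" by (simp_all add: tasks_def jobs_def)
    then have "good_schedule I (discarded I s) (schedule s)" "card (discarded I s) = 0" for s
      by (simp_all add: good_schedule_def discarded_def)
    moreover have "2 \<le> poly P (input_size I)"
      by (simp add: P scheduler_time_def)
    ultimately show ?thesis
      using exec_scheduler_no_jobs[OF True] by (metis zero_le)
  next
    case False
    then have n: "0 < num_jobs I" by simp
    note B = size_bounds[OF I S n]
    obtain k s where s: "exec scheduler (input I) k s"
        "k \<le> scheduler_time (num_jobs I) (num_machines I) (horizon I) (input_size I)"
        "good_schedule I (discarded I s) (schedule s)"
        "card (discarded I s) \<le> num_machines I * max_chain I"
      using wp_scheduler[OF I S n B(5)] unfolding wp_def by blast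
    have "k \<le> poly P (input_size I)"
      unfolding P using s(2) scheduler_time_mono[OF B(2,3,4) order_refl] by (rule le_trans)
    moreover have "card (discarded I s) \<le> 2 * (num_intervals I)\<^sup>2 * num_machines I * max_chain I"
    proof -
      \<comment> \<open>The program achieves m \<Delta>; this factor turns it into the stated
        bound.\<close>
      have "1 \<le> 2 * (num_intervals I)\<^sup>2"
        using B(1) by (simp add: Suc_le_eq)
      from mult_le_mono1[OF this, of "num_machines I * max_chain I"] show ?thesis
        using s(4) unfolding mult_1 mult.assoc[of _ "num_machines I"] by (rule le_trans[rotated])
    qed
    ultimately show ?thesis
      using s(1,3) by blast
  qed
  then show ?thesis by blast
qed

end
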